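(* Let $L_0$ be a positive definite even lattice with dual lattice $L$, and let $\gamma\in L$ with $\gamma\notin L_0$. Let $V=V_{L_0}$ be the lattice vertex operator algebra and $W=V_{\gamma+L_0}$ its irreducible module, with grading operator $\mathbf d_W=L(0)$. Then every derivation $F:V_{L_0}\to V_{\gamma+L_0}$ is a zero-mode derivation. Consequently, $H^1(V_{L_0},V_{\gamma+L_0})=Z^1(V_{L_0},V_{\gamma+L_0})$.
   Context: Lattice VOA and modules. $L_0$ is a free abelian group of finite rank with a positive definite symmetric $\mathbb Z$-bilinear form such that $\langle\alpha,\alpha\rangle\in2\mathbb Z$ for all $\alpha\in L_0$; $\mathfrak h=L_0\otimes_{\mathbb Z}\mathbb C$ and $L=\{\alpha\in\mathfrak h:\langle\alpha,\beta\rangle\in\mathbb Z\ \forall\beta\in L_0\}$. $M(1)$ is the level-one Heisenberg (Fock) module for $\hat{\mathfrak h}=\mathfrak h\otimes\mathbb C[t,t^{-1}]\oplus\mathbb Ck$, with $h(n)=h\otimes t^n$. $\mathbb C\{L\}$ has basis $\iota(e_\alpha)$, $\alpha\in L$, with operators $e_\alpha\cdot\iota(e_\beta)=\epsilon(\alpha,\beta)\iota(e_{\alpha+\beta})$ for a normalized 2-cocycle $\epsilon$ on $L$ with values in roots of unity satisfying $\epsilon(\alpha,\beta)/\epsilon(\beta,\alpha)=(-1)^{\langle\alpha,\beta\rangle}$ for $\alpha,\beta\in L_0$. On $V_L=M(1)\otimes\mathbb C\{L\}$, $h(n)$ for $n\ne0$ acts on the first factor, $h(0)$ acts on $v\otimes\iota(e_\alpha)$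 by $\langle h,\alpha\rangle$, and $x^{\alpha}$ acts on $v\otimes\iota(e_\beta)$ by $x^{\langle\alpha,\beta\rangle}$. For $E\subset L$, $V_E=M(1)\otimes\mathrm{span}\{\iota(e_\alpha):\alpha\in E\}$. $V_{L_0}$ is a VOA and $V_{\gamma+L_0}$ is an irreducible $V_{L_0}$-module with the standard vertex operators determined by $Y(\iota(e_\alpha),x)=\exp\left(-\sum_{n<0}\frac{\alpha(n)}nx^{-n}\right)\exp\left(-\sum_{n>0}\frac{\alpha(n)}nx^{-n}\right)e_\alpha x^\alpha$ and $Y(h(-1)\mathbf 1,x)=\sum_nh(n)x^{-n-1}$. The $L(0)$-weight of $a^{(1)}(-n_1)\cdots a^{(m)}(-n_m)\iota(e_\alpha)$ is $n_1+\cdots+n_m+\frac{\langle\alpha,\alpha\rangle}2$. Derivations. For a vertex operator algebra $(V,Y,\mathbf 1,\omega)$ and a $V$-module $(W,Y_W)$ with grading operator $\mathbf d_W$, put $W_{[m]}=\{w\in W:\mathbf d_Ww=mw\}$ and $Y_{WV}^W(w,x)v=e^{xL(-1)}Y_W(v,-x)w=\sum_{n\in\mathbb Z}w_nv\,x^{-n-1}$ for $w\in W,v\in V$. A (grading-preserving) derivation is a linear map $F:V\to W$ with $F\circ L(0)=\mathbf d_W\circ F$ and $F(Y(u,x)v)=Y_W(u,x)F(v)+Y_{WV}^W(F(u),x)v$ for all $u,v\in V$. $H^1(V,W)$ is (identified with) the space of all such derivations. A zero-mode derivation is one of the form $v\mapsto w_0v$ with $w\in W_{[1]}$; $Z^1(V,W)$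 is the space of these. *)

theory Defs
  imports
    "HOL-Analysis.Analysis"
    "HOL-Library.Multiset"
    "HOL-Library.Poly_Mapping"
    "HOL-Library.FuncSet"
begin

section \<open>Derivations of vertex operator algebras\<close>

text \<open>
  A vertex operator \<open>Y(u,x) = \<Sum>n. u_n x^(-n-1)\<close> is recorded through its modes:
  \<open>vmode V u n\<close> is the operator \<open>u_n\<close> on the algebra and \<open>mmode W u n\<close> the operator
  \<open>u_n\<close> on the module. The underlying spaces are subsets of the ambient types.
  The records only carry the data \<open>(V, Y, 1, \<omega>)\<close> and \<open>(W, Y_W, d_W)\<close>; the VOA and
  module axioms play no role in the definitions of this section.
\<close>

record 'v voa_data =
  vspace :: "'v set"
  vscale :: "complex \<Rightarrow> 'v \<Rightarrow> 'v"
  vmode :: "'v \<Rightarrow> int \<Rightarrow> 'v \<Rightarrow> 'v"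
  vacuum :: "'v"
  conformal :: "'v"

record ('v, 'w) voa_module_data =
  mspace :: "'w set"
  mscale :: "complex \<Rightarrow> 'w \<Rightarrow> 'w"
  mmode :: "'v \<Rightarrow> int \<Rightarrow> 'w \<Rightarrow> 'w"
  mgrading :: "'w \<Rightarrow> 'w"

text \<open>The Virasoro modes \<open>L(n) = \<omega>_(n+1)\<close> on the algebra and on a module.\<close>

definition L_alg :: "'v voa_data \<Rightarrow> int \<Rightarrow> 'v \<Rightarrow> 'v" where
  "L_alg V n = vmode V (conformal V) (n + 1)"

definition L_mod :: "'v voa_data \<Rightarrow> ('v, 'w) voa_module_data \<Rightarrow> int \<Rightarrow> 'w \<Rightarrow> 'w" where
  "L_mod V W n = mmode W (conformal V) (n + 1)"

definition weight_space :: "('v, 'w) voa_module_data \<Rightarrow> complex \<Rightarrow> 'w set" where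
  "weight_space W m = {w \<in> mspace W. mgrading W w = mscale W m w}"

text \<open>
  The mode \<open>w_n v\<close> of \<open>Y_WV^W(w,x)v = e^(xL(-1)) Y_W(v,-x)w\<close>. Since
  \<open>Y_W(v,-x)w = \<Sum>k. (-1)^(k+1) v_k w x^(-k-1)\<close>, the term \<open>x^j L(-1)^j / j!\<close> of the
  exponential contributes to \<open>x^(-n-1)\<close> through \<open>k = n + j\<close>. Only finitely many \<open>j\<close>
  contribute in a module.
\<close>

definition skew_mode ::
    "'v voa_data \<Rightarrow> ('v, 'w::comm_monoid_add) voa_module_data \<Rightarrow> 'w \<Rightarrow> int \<Rightarrow> 'v \<Rightarrow> 'w" where
  "skew_mode V W w n v =
     Sum_any (\<lambda>j::nat. mscale W ((-1) powi (n + int j + 1) / fact j)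
       ((L_mod V W (-1) ^^ j) (mmode W v (n + int j) w)))"

text \<open>
  Derivations are functions on the whole ambient type of which only the values on
  \<open>vspace V\<close> matter.
\<close>

definition is_derivation ::
    "('v::comm_monoid_add) voa_data \<Rightarrow> ('v, 'w::comm_monoid_add) voa_module_data \<Rightarrow>
     ('v \<Rightarrow> 'w) \<Rightarrow> bool" where
  "is_derivation V W F \<longleftrightarrow>
     (\<forall>u\<in>vspace V. F u \<in> mspace W) \<and>
     (\<forall>u\<in>vspace V. \<forall>v\<in>vspace V. F (u + v) = F u + F v) \<and>
     (\<forall>c. \<forall>u\<in>vspace V. F (vscale V c u) = mscale W c (F u)) \<and>
     (\<forall>u\<in>vspace V. F (L_alg V 0 u) = mgrading W (F u)) \<and>
     (\<forall>u\<in>vspace V. \<forall>v\<in>vspace V. \<forall>n.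
        F (vmode V u n v) = mmode W u n (F v) + skew_mode V W (F u) n v)"

definition is_zero_mode_derivation ::
    "('v::comm_monoid_add) voa_data \<Rightarrow> ('v, 'w::comm_monoid_add) voa_module_data \<Rightarrow>
     ('v \<Rightarrow> 'w) \<Rightarrow> bool" where
  "is_zero_mode_derivation V W F \<longleftrightarrow>
     is_derivation V W F \<and>
     (\<exists>w\<in>weight_space W 1. \<forall>v\<in>vspace V. F v = skew_mode V W w 0 v)"

text \<open>
  The restriction to \<open>extensional (vspace V)\<close> picks one function on the ambient type for
  each map on \<open>vspace V\<close>.
\<close>

definition H1 ::
    "('v::comm_monoid_add) voa_data \<Rightarrow> ('v, 'w::comm_monoid_add) voa_module_data \<Rightarrow>
     ('v \<Rightarrow> 'w) set" where
  "H1 V W = {F \<in> extensional (vspace V). is_derivation V W F}"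

definition Z1 ::
    "('v::comm_monoid_add) voa_data \<Rightarrow> ('v, 'w::comm_monoid_add) voa_module_data \<Rightarrow>
     ('v \<Rightarrow> 'w) set" where
  "Z1 V W = {F \<in> extensional (vspace V). is_zero_mode_derivation V W F}"


section \<open>Even lattices\<close>

text \<open>
  The space \<open>\<hh> = L0 \<otimes> \<complex>\<close> is \<open>complex^'n\<close> and \<open>L0\<close> is the \<open>\<int>\<close>-span of some
  \<open>\<complex>\<close>-basis of it; \<open>B\<close> is the \<open>\<complex>\<close>-bilinear extension to \<open>\<hh>\<close> of the form on \<open>L0\<close>.
  No relation between \<open>L0\<close> or \<open>B\<close> and the standard basis \<open>axis i 1\<close> is assumed.
  Rank zero is not covered by the type \<open>complex^'n\<close>, but there the dual lattice is \<open>L0\<close>.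
\<close>

definition even_lattice :: "(complex^'n \<Rightarrow> complex^'n \<Rightarrow> complex) \<Rightarrow> (complex^'n) set \<Rightarrow> bool" where
  "even_lattice B L0 \<longleftrightarrow>
     (\<forall>x. Vector_Spaces.linear (*s) (*) (B x)) \<and>
     (\<forall>y. Vector_Spaces.linear (*s) (*) (\<lambda>x. B x y)) \<and>
     (\<forall>x y. B x y = B y x) \<and>
     (\<exists>S. vec.independent S \<and> vec.span S = UNIV \<and>
          L0 = {\<Sum>b\<in>S. of_int (z b) *s b | z :: complex^'n \<Rightarrow> int. True}) \<and>
     (\<forall>\<alpha>\<in>L0. \<forall>\<beta>\<in>L0. B \<alpha> \<beta> \<in> \<int>) \<and>
     (\<forall>\<alpha>\<in>L0. \<exists>k::int. B \<alpha> \<alpha> = of_int (2 * k)) \<and>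
     (\<forall>\<alpha>\<in>L0. \<alpha> \<noteq> 0 \<longrightarrow> 0 < Re (B \<alpha> \<alpha>))"

definition dual_lattice ::
    "(complex^'n \<Rightarrow> complex^'n \<Rightarrow> complex) \<Rightarrow> (complex^'n) set \<Rightarrow> (complex^'n) set" where
  "dual_lattice B L0 = {\<alpha>. \<forall>\<beta>\<in>L0. B \<alpha> \<beta> \<in> \<int>}"

definition lattice_cocycle ::
    "(complex^'n \<Rightarrow> complex^'n \<Rightarrow> complex) \<Rightarrow> (complex^'n) set \<Rightarrow>
     (complex^'n \<Rightarrow> complex^'n \<Rightarrow> complex) \<Rightarrow> bool" where
  "lattice_cocycle B L0 \<epsilon> \<longleftrightarrow>
     (let L = dual_lattice B L0 in
       (\<forall>\<alpha>\<in>L. \<forall>\<beta>\<in>L. \<exists>k::nat. 0 < k \<and> \<epsilon> \<alpha> \<beta> ^ k = 1) \<and>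
       (\<forall>\<alpha>\<in>L. \<epsilon> \<alpha> 0 = 1 \<and> \<epsilon> 0 \<alpha> = 1) \<and>
       (\<forall>\<alpha>\<in>L. \<forall>\<beta>\<in>L. \<forall>\<gamma>\<in>L. \<epsilon> \<alpha> \<beta> * \<epsilon> (\<alpha> + \<beta>) \<gamma> = \<epsilon> \<beta> \<gamma> * \<epsilon> \<alpha> (\<beta> + \<gamma>)) \<and>
       (\<forall>\<alpha>\<in>L0. \<forall>\<beta>\<in>L0. \<forall>k::int. B \<alpha> \<beta> = of_int k \<longrightarrow> \<epsilon> \<alpha> \<beta> / \<epsilon> \<beta> \<alpha> = (-1) powi k))"


section \<open>The space \<open>M(1) \<otimes> \<complex>{L}\<close> and its operators\<close>

text \<open>
  \<open>M(1)\<close> is the polynomial algebra in the commuting variables \<open>e_i(-n)\<close> with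
  \<open>e_i = axis i 1\<close> and \<open>n \<ge> 1\<close>. The pair \<open>(i, r)\<close> encodes \<open>e_i(-r-1)\<close>, so that all
  natural numbers \<open>r\<close> occur; a multiset of such pairs is a monomial, and the basis vector
  \<open>single (M, \<alpha>) 1\<close> is this monomial tensored with \<open>\<iota>(e_\<alpha>)\<close>.
\<close>

type_synonym 'n fock_basis = "('n \<times> nat) multiset \<times> (complex^'n)"
type_synonym 'n fock = "'n fock_basis \<Rightarrow>\<^sub>0 complex"

definition fock_scale :: "complex \<Rightarrow> 'n fock \<Rightarrow> 'n fock" where
  "fock_scale c v = Poly_Mapping.map ((*) c) v"

definition fock_extend :: "('n fock_basis \<Rightarrow> 'n fock) \<Rightarrow> 'n fock \<Rightarrow> 'n fock" where
  "fock_extend f v = (\<Sum>b\<in>Poly_Mapping.keys v. fock_scale (Poly_Mapping.lookup v b) (f b))"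

definition fock_space :: "(complex^'n) set \<Rightarrow> 'n fock set" where
  "fock_space E = {v. \<forall>b\<in>Poly_Mapping.keys v. snd b \<in> E}"

text \<open>
  \<open>heis B h n\<close> is \<open>h(n)\<close>. For \<open>n > 0\<close> it is the derivation of the polynomial algebra with
  \<open>h(n) e_i(-m) = n \<langle>h,e_i\<rangle> \<delta>(n,m)\<close>.
\<close>

definition heis ::
    "(complex^'n \<Rightarrow> complex^'n \<Rightarrow> complex) \<Rightarrow> complex^'n \<Rightarrow> int \<Rightarrow> 'n fock \<Rightarrow> 'n fock" where
  "heis B h n = fock_extend (\<lambda>(M, \<alpha>).
     if n < 0 then
       \<Sum>i\<in>UNIV. Poly_Mapping.single (add_mset (i, nat (- n) - 1) M, \<alpha>) (h $ i)
     else if n = 0 then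
       Poly_Mapping.single (M, \<alpha>) (B h \<alpha>)
     else
       \<Sum>i\<in>UNIV. Poly_Mapping.single (M - {#(i, nat n - 1)#}, \<alpha>)
          (of_int n * B h (axis i 1) * of_nat (count M (i, nat n - 1))))"

definition e_op ::
    "(complex^'n \<Rightarrow> complex^'n \<Rightarrow> complex) \<Rightarrow> complex^'n \<Rightarrow> 'n fock \<Rightarrow> 'n fock" where
  "e_op \<epsilon> \<alpha> = fock_extend (\<lambda>(M, \<beta>). Poly_Mapping.single (M, \<alpha> + \<beta>) (\<epsilon> \<alpha> \<beta>))"

text \<open>
  \<open>series_power A k N\<close> is the coefficient of \<open>x^N\<close> in the \<open>k\<close>-th power of the
  operator-valued series \<open>\<Sum>j\<ge>1. A j x^j\<close>, and \<open>series_exp A N\<close> the coefficient of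
  \<open>x^N\<close> in its exponential; powers with \<open>k > N\<close> do not contribute.
\<close>

fun series_power :: "(nat \<Rightarrow> 'n fock \<Rightarrow> 'n fock) \<Rightarrow> nat \<Rightarrow> nat \<Rightarrow> 'n fock \<Rightarrow> 'n fock" where
  "series_power A 0 N v = (if N = 0 then v else 0)"
| "series_power A (Suc k) N v = (\<Sum>j=1..N. A j (series_power A k (N - j) v))"

definition series_exp :: "(nat \<Rightarrow> 'n fock \<Rightarrow> 'n fock) \<Rightarrow> nat \<Rightarrow> 'n fock \<Rightarrow> 'n fock" where
  "series_exp A N v = (\<Sum>k\<le>N. fock_scale (1 / fact k) (series_power A k N v))"

text \<open>
  \<open>E_minus B \<alpha> p\<close> is the coefficient of \<open>x^p\<close> in \<open>exp(-\<Sum>n<0. \<alpha>(n)/n x^(-n))\<close>, where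
  \<open>n = -j\<close> gives the summand \<open>\<alpha>(-j)/j x^j\<close>, and \<open>E_plus B \<alpha> q\<close> is the coefficient of
  \<open>x^(-q)\<close> in \<open>exp(-\<Sum>n>0. \<alpha>(n)/n x^(-n))\<close>.
\<close>

definition E_minus ::
    "(complex^'n \<Rightarrow> complex^'n \<Rightarrow> complex) \<Rightarrow> complex^'n \<Rightarrow> nat \<Rightarrow> 'n fock \<Rightarrow> 'n fock" where
  "E_minus B \<alpha> = series_exp (\<lambda>j v. fock_scale (1 / of_nat j) (heis B \<alpha> (- int j) v))"

definition E_plus ::
    "(complex^'n \<Rightarrow> complex^'n \<Rightarrow> complex) \<Rightarrow> complex^'n \<Rightarrow> nat \<Rightarrow> 'n fock \<Rightarrow> 'n fock" where
  "E_plus B \<alpha> = series_exp (\<lambda>j v. fock_scale (- 1 / of_nat j) (heis B \<alpha> (int j) v))"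

text \<open>
  The mode \<open>n\<close>, i.e. the coefficient of \<open>x^(-n-1)\<close>, of \<open>Y(\<iota>(e_\<alpha>),x)\<close>. On the sector of
  \<open>\<beta>\<close> the factor \<open>x^\<alpha>\<close> is \<open>x^d\<close> with \<open>d = \<langle>\<alpha>,\<beta>\<rangle>\<close>, an integer for \<open>\<alpha> \<in> L0\<close> and
  \<open>\<beta> \<in> L\<close>; the value of \<open>d\<close> elsewhere is irrelevant. The contributing products
  \<open>x^p x^(-q) x^d\<close> are those with \<open>p - q + d = -n-1\<close>.
\<close>

definition exp_mode ::
    "(complex^'n \<Rightarrow> complex^'n \<Rightarrow> complex) \<Rightarrow> (complex^'n \<Rightarrow> complex^'n \<Rightarrow> complex) \<Rightarrow>
     complex^'n \<Rightarrow> int \<Rightarrow> 'n fock \<Rightarrow> 'n fock" where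
  "exp_mode B \<epsilon> \<alpha> n = fock_extend (\<lambda>(M, \<beta>).
     Sum_any (\<lambda>q::nat.
       let d = \<lfloor>Re (B \<alpha> \<beta>)\<rfloor>; p = int q - d - n - 1 in
       if p < 0 then 0
       else E_minus B \<alpha> (nat p) (E_plus B \<alpha> q (e_op \<epsilon> \<alpha> (Poly_Mapping.single (M, \<beta>) 1)))))"

text \<open>
  For a field \<open>A(x) = \<Sum>l. A l x^(-l-1)\<close>, the mode \<open>n\<close> of the normally ordered product
  \<open>:(1/r! (d/dx)^r h(x)) A(x):\<close> with \<open>h(x) = \<Sum>m. h(m) x^(-m-1)\<close>, in which the \<open>h(m)\<close>
  with \<open>m < 0\<close> stand to the left and those with \<open>m \<ge> 0\<close> to the right of \<open>A\<close>. Here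
  \<open>1/r! (d/dx)^r x^(-m-1) = ((-m-1) gchoose r) x^(-m-1-r)\<close>.
\<close>

definition normal_ordered ::
    "(complex^'n \<Rightarrow> complex^'n \<Rightarrow> complex) \<Rightarrow> complex^'n \<Rightarrow> nat \<Rightarrow>
     (int \<Rightarrow> 'n fock \<Rightarrow> 'n fock) \<Rightarrow> int \<Rightarrow> 'n fock \<Rightarrow> 'n fock" where
  "normal_ordered B h r A n v =
     Sum_any (\<lambda>m::int. fock_scale (of_int (- m - 1) gchoose r)
       (if m < 0 then heis B h m (A (n - m - int r - 1) v)
        else A (n - m - int r - 1) (heis B h m v)))"

text \<open>
  The standard vertex operator of \<open>h1(-r1-1) \<dots> hk(-rk-1) \<iota>(e_\<alpha>)\<close>, namely
  \<open>:(1/r1! (d/dx)^r1 h1(x)) \<dots> (1/rk! (d/dx)^rk hk(x)) Y(\<iota>(e_\<alpha>),x):\<close>, for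
  \<open>h1, \<dots>, hk\<close> among the \<open>e_i\<close>.
\<close>

fun word_mode ::
    "(complex^'n \<Rightarrow> complex^'n \<Rightarrow> complex) \<Rightarrow> (complex^'n \<Rightarrow> complex^'n \<Rightarrow> complex) \<Rightarrow>
     ('n \<times> nat) list \<Rightarrow> complex^'n \<Rightarrow> int \<Rightarrow> 'n fock \<Rightarrow> 'n fock" where
  "word_mode B \<epsilon> [] \<alpha> = exp_mode B \<epsilon> \<alpha>"
| "word_mode B \<epsilon> ((i, r) # ws) \<alpha> = normal_ordered B (axis i 1) r (word_mode B \<epsilon> ws \<alpha>)"

text \<open>
  Normally ordered products do not depend on the order of the factors, so any enumeration
  of the monomial may be chosen.
\<close>

definition lattice_mode ::
    "(complex^'n \<Rightarrow> complex^'n \<Rightarrow> complex) \<Rightarrow> (complex^'n \<Rightarrow> complex^'n \<Rightarrow> complex) \<Rightarrow>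
     'n fock \<Rightarrow> int \<Rightarrow> 'n fock \<Rightarrow> 'n fock" where
  "lattice_mode B \<epsilon> u n v =
     (\<Sum>(M, \<alpha>)\<in>Poly_Mapping.keys u.
        fock_scale (Poly_Mapping.lookup u (M, \<alpha>)) (word_mode B \<epsilon> (SOME ws. mset ws = M) \<alpha> n v))"

text \<open>
  \<open>\<omega> = 1/2 \<Sum>i. e_i(-1) e^i(-1) 1\<close> with \<open>e^i\<close> the basis dual to \<open>e_i\<close> with respect to
  \<open>B\<close>, expressed through the inverse of the Gram matrix.
\<close>

definition lattice_conformal :: "(complex^'n \<Rightarrow> complex^'n \<Rightarrow> complex) \<Rightarrow> 'n fock" where
  "lattice_conformal B =
     (let G = matrix_inv (\<chi> i j. B (axis i 1) (axis j 1)) in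
       \<Sum>i\<in>UNIV. \<Sum>j\<in>UNIV. Poly_Mapping.single ({#(i, 0), (j, 0)#}, 0) (G $ i $ j / 2))"

definition lattice_voa ::
    "(complex^'n \<Rightarrow> complex^'n \<Rightarrow> complex) \<Rightarrow> (complex^'n) set \<Rightarrow>
     (complex^'n \<Rightarrow> complex^'n \<Rightarrow> complex) \<Rightarrow> 'n fock voa_data" where
  "lattice_voa B L0 \<epsilon> =
     \<lparr>vspace = fock_space L0,
      vscale = fock_scale,
      vmode = lattice_mode B \<epsilon>,
      vacuum = Poly_Mapping.single ({#}, 0) 1,
      conformal = lattice_conformal B\<rparr>"

text \<open>The module \<open>V_(\<gamma>+L0)\<close>, with grading operator \<open>L(0) = \<omega>_1\<close>.\<close>

definition lattice_module ::
    "(complex^'n \<Rightarrow> complex^'n \<Rightarrow> complex) \<Rightarrow> (complex^'n) set \<Rightarrow>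
     (complex^'n \<Rightarrow> complex^'n \<Rightarrow> complex) \<Rightarrow> complex^'n \<Rightarrow>
     ('n fock, 'n fock) voa_module_data" where
  "lattice_module B L0 \<epsilon> \<gamma> =
     \<lparr>mspace = fock_space ((+) \<gamma> ` L0),
      mscale = fock_scale,
      mmode = lattice_mode B \<epsilon>,
      mgrading = lattice_mode B \<epsilon> (lattice_conformal B) 1\<rparr>"

end

theory Submission
  imports Defs
begin

text \<open>
  Put \<open>a\<^sub>i = F(e\<^sub>i(-1)1)\<close>; it has weight one because \<open>F\<close> preserves the grading.
  The derivation rule for the mode \<open>e\<^sub>i(0)\<close> reads
  \<open>F(e\<^sub>i(0) v) = e\<^sub>i(0) F(v) + (a\<^sub>i)\<^sub>0 v\<close>. For \<open>v\<close> in the sector of \<open>\<alpha>\<close>, its component in the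
  sector of \<open>\<delta>\<close> is \<open>-\<langle>e\<^sub>i, \<delta> - \<alpha>\<rangle> F(v)\<^sub>\<delta> = ((a\<^sub>i)\<^bsub>\<delta>-\<alpha>\<^esub>)\<^sub>0 v\<close>, since modes shift sectors. As
  \<open>\<delta> - \<alpha>\<close> lies in \<open>\<gamma> + L0\<close>, it is nonzero, so by nondegeneracy some \<open>\<langle>e\<^sub>i, \<delta> - \<alpha>\<rangle>\<close> is
  nonzero and \<open>F(v)\<^sub>\<delta>\<close> can be solved for. Hence \<open>F(v) = w\<^sub>0 v\<close>, where the component of \<open>w\<close> in
  the sector of \<open>\<beta>\<close> is \<open>-(a\<^sub>i)\<^sub>\<beta> / \<langle>e\<^sub>i, \<beta>\<rangle>\<close> for such an \<open>i = i(\<beta>)\<close>.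
\<close>

section \<open>Linear operators on the Fock space\<close>

lemma lookup_fock_scale [simp]:
  "Poly_Mapping.lookup (fock_scale c v) b = c * Poly_Mapping.lookup v b"
  by (simp add: fock_scale_def map.rep_eq when_def)

interpretation fock: vector_space fock_scale
  by standard (auto intro!: poly_mapping_eqI simp: lookup_add algebra_simps)

interpretation fock: vector_space_pair fock_scale fock_scale ..

abbreviation fock_linear :: "('n::finite fock \<Rightarrow> 'n fock) \<Rightarrow> bool" where
  "fock_linear \<equiv> Vector_Spaces.linear fock_scale fock_scale"

lemma fock_linearI:
  assumes "\<And>u v. T (u + v) = T u + T v" and "\<And>c v. T (fock_scale c v) = fock_scale c (T v)"
  shows "fock_linear T"
  using assms by unfold_locales auto

lemma fock_scale_single [simp]:
  "fock_scale c (Poly_Mapping.single b d) = Poly_Mapping.single b (c * d)"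
  by (rule poly_mapping_eqI) (simp add: lookup_single when_def)

lemma fock_linear_compose: "fock_linear S \<Longrightarrow> fock_linear T \<Longrightarrow> fock_linear (\<lambda>v. S (T v))"
  by (rule Vector_Spaces.linear_compose[unfolded o_def])

lemma fock_extend_superset:
  assumes "finite A" "Poly_Mapping.keys v \<subseteq> A"
  shows "fock_extend f v = (\<Sum>b\<in>A. fock_scale (Poly_Mapping.lookup v b) (f b))"
  unfolding fock_extend_def using assms
  by (intro sum.mono_neutral_left) (auto simp: in_keys_iff)

lemma fock_extend_linear:
  fixes f :: "'n::finite fock_basis \<Rightarrow> 'n fock"
  shows "fock_linear (fock_extend f)"
proof (rule fock_linearI)
  fix u v :: "'n fock" and c
  let ?A = "Poly_Mapping.keys u \<union> Poly_Mapping.keys v"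
  have "Poly_Mapping.keys (u + v) \<subseteq> ?A"
    by (rule Poly_Mapping.keys_add)
  then show "fock_extend f (u + v) = fock_extend f u + fock_extend f v"
    by (simp add: fock_extend_superset[of ?A] lookup_add fock.scale_left_distrib sum.distrib)
  have "Poly_Mapping.keys (fock_scale c v) \<subseteq> Poly_Mapping.keys v"
    by (auto simp: in_keys_iff)
  then show "fock_extend f (fock_scale c v) = fock_scale c (fock_extend f v)"
    by (simp add: fock_extend_superset[of "Poly_Mapping.keys v"] fock.scale_sum_right)
qed

lemma fock_extend_single [simp]: "fock_extend f (Poly_Mapping.single b c) = fock_scale c (f b)"
  by (subst fock_extend_superset[of "{b}"]) auto

lemma fock_eq_sum_single:
  "v = (\<Sum>b\<in>Poly_Mapping.keys v. fock_scale (Poly_Mapping.lookup v b) (Poly_Mapping.single b 1))"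
  by (rule poly_mapping_eqI) (auto simp: lookup_sum lookup_single when_def in_keys_iff)

lemma fock_linear_eq_extend:
  assumes "fock_linear T"
  shows "T v = fock_extend (\<lambda>b. T (Poly_Mapping.single b 1)) v"
proof -
  interpret T: Vector_Spaces.linear fock_scale fock_scale T by fact
  show ?thesis
    by (subst (1) fock_eq_sum_single) (simp add: T.sum T.scale fock_extend_def del: fock_scale_single)
qed

text \<open>Only basis vectors in the support of \<open>v\<close> are tested, so two operators can
  be compared on vectors over the dual lattice, where the cocycle is controlled, even if they differ
  elsewhere.\<close>

lemma fock_linear_eqI:
  assumes "fock_linear S" "fock_linear T"
    and "\<And>b. b \<in> Poly_Mapping.keys v \<Longrightarrow> S (Poly_Mapping.single b 1) = T (Poly_Mapping.single b 1)"
  shows "S v = T v"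
  using assms by (simp add: fock_linear_eq_extend[of S v] fock_linear_eq_extend[of T v] fock_extend_def)

text \<open>Finite support is essential: \<open>Sum_any\<close> takes the default value 0 on
  families of infinite support.\<close>

lemma linear_Sum_any:
  assumes "fock_linear T" "finite {a. f a \<noteq> 0}"
  shows "T (Sum_any f) = Sum_any (\<lambda>a. T (f a))"
proof -
  interpret T: Vector_Spaces.linear fock_scale fock_scale T by fact
  have "{a. T (f a) \<noteq> 0} \<subseteq> {a. f a \<noteq> 0}" by auto
  then have "Sum_any (\<lambda>a. T (f a)) = (\<Sum>a | f a \<noteq> 0. T (f a))"
    by (rule Sum_any.expand_superset[OF assms(2)])
  then show ?thesis
    by (simp add: Sum_any.expand_set T.sum)
qed

lemma linear_combination_Sum_any:
  assumes "\<And>a. fock_linear (g a)" "\<And>v. finite {a. g a v \<noteq> 0}"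
  shows "fock_linear (\<lambda>v. Sum_any (\<lambda>a. g a v))"
proof (rule fock_linearI)
  fix u v c
  have g: "g a (u + v) = g a u + g a v" "g a (fock_scale c v) = fock_scale c (g a v)" for a
    using assms(1)[of a] by (simp_all add: fock.linear_add fock.linear_scale)
  show "Sum_any (\<lambda>a. g a (u + v)) = Sum_any (\<lambda>a. g a u) + Sum_any (\<lambda>a. g a v)"
    using assms(2) by (simp add: g Sum_any.distrib)
  show "Sum_any (\<lambda>a. g a (fock_scale c v)) = fock_scale c (Sum_any (\<lambda>a. g a v))"
    using linear_Sum_any[OF fock.linear_scale_self assms(2)] by (simp add: g)
qed

section \<open>Projections onto the sectors M(1) \<otimes> \<iota>(e_\<beta>)\<close>

definition sector :: "complex^'n \<Rightarrow> 'n::finite fock \<Rightarrow> 'n fock" where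
  "sector \<beta> = fock_extend (\<lambda>b. if snd b = \<beta> then Poly_Mapping.single b 1 else 0)"

lemma sector_linear: "fock_linear (sector \<beta>)"
  unfolding sector_def by (rule fock_extend_linear)

lemma sector_single [simp]:
  "sector \<beta> (Poly_Mapping.single b c) = (if snd b = \<beta> then Poly_Mapping.single b c else 0)"
  by (simp add: sector_def)

lemmas sector_simps [simp] =
  fock.linear_add[OF sector_linear] fock.linear_scale[OF sector_linear]
  fock.linear_0[OF sector_linear] fock.linear_sum[OF sector_linear]

lemma lookup_sector:
  "Poly_Mapping.lookup (sector \<beta> v) b = (if snd b = \<beta> then Poly_Mapping.lookup v b else 0)"
proof -
  have "Poly_Mapping.lookup (sector \<beta> v) b =
      (\<Sum>k\<in>Poly_Mapping.keys v. if k = b then (if snd b = \<beta> then Poly_Mapping.lookup v b else 0) else 0)"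
    unfolding sector_def fock_extend_def lookup_sum
    by (rule sum.cong) (auto simp: lookup_single when_def)
  also have "\<dots> = (if snd b = \<beta> then Poly_Mapping.lookup v b else 0)"
    by (auto simp: in_keys_iff)
  finally show ?thesis .
qed

lemma sector_sector: "sector \<beta> (sector \<delta> v) = (if \<beta> = \<delta> then sector \<beta> v else 0)"
  by (rule poly_mapping_eqI) (simp add: lookup_sector)

lemma fock_eqI_sector: "(\<And>\<beta>. sector \<beta> u = sector \<beta> v) \<Longrightarrow> u = v"
  by (rule poly_mapping_eqI) (metis lookup_sector)

lemma sector_eq_0_iff: "sector \<beta> v = 0 \<longleftrightarrow> \<beta> \<notin> snd ` Poly_Mapping.keys v"
proof
  assume "sector \<beta> v = 0"
  then have "snd b = \<beta> \<Longrightarrow> Poly_Mapping.lookup v b = 0" for b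
    by (metis lookup_sector lookup_zero)
  then show "\<beta> \<notin> snd ` Poly_Mapping.keys v"
    by (auto simp: in_keys_iff)
next
  assume "\<beta> \<notin> snd ` Poly_Mapping.keys v"
  then show "sector \<beta> v = 0"
    by (intro poly_mapping_eqI) (auto simp: lookup_sector in_keys_iff)
qed

text \<open>Turns membership into equations between projections, which sector-shifting operators
  transport directly.\<close>

lemma fock_space_iff: "v \<in> fock_space E \<longleftrightarrow> (\<forall>\<beta>. \<beta> \<notin> E \<longrightarrow> sector \<beta> v = 0)"
  by (auto simp: fock_space_def sector_eq_0_iff)

section \<open>Operators that shift sectors\<close>

text \<open>Stated as an exchange law with the projections, for all vectors, rather than as an
  inclusion of sectors: it then rewrites and passes at once to sums and compositions.\<close>

definition shift_op :: "complex^'n \<Rightarrow> ('n::finite fock \<Rightarrow> 'n fock) \<Rightarrow> bool" where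
  "shift_op \<alpha> T \<longleftrightarrow> fock_linear T \<and> (\<forall>\<beta> v. sector (\<alpha> + \<beta>) (T v) = T (sector \<beta> v))"

lemma shift_op_linear: "shift_op \<alpha> T \<Longrightarrow> fock_linear T"
  and shift_op_sector: "shift_op \<alpha> T \<Longrightarrow> sector (\<alpha> + \<beta>) (T v) = T (sector \<beta> v)"
  by (simp_all add: shift_op_def)

lemma shift_op_sector': "shift_op \<alpha> T \<Longrightarrow> sector \<delta> (T v) = T (sector (\<delta> - \<alpha>) v)"
  using shift_op_sector[of \<alpha> T "\<delta> - \<alpha>"] by simp

lemma shift_op_scale: "shift_op \<alpha> T \<Longrightarrow> T (fock_scale c v) = fock_scale c (T v)"
  and shift_op_0: "shift_op \<alpha> T \<Longrightarrow> T 0 = 0"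
  by (auto simp: shift_op_def fock.linear_scale fock.linear_0)

lemma shift_op_fock_space:
  assumes "shift_op 0 T" "v \<in> fock_space E"
  shows "T v \<in> fock_space E"
  using assms by (simp add: fock_space_iff shift_op_sector' shift_op_0)

lemma shift_op_extend:
  assumes "\<And>b \<beta>. \<beta> \<noteq> \<alpha> + snd b \<Longrightarrow> sector \<beta> (f b) = 0"
  shows "shift_op \<alpha> (fock_extend f)"
  unfolding shift_op_def
proof (intro conjI allI fock_extend_linear)
  fix \<beta> v
  \<comment> \<open>All other components of \<open>f b\<close> vanish, so it equals its projection
    to the one remaining sector.\<close>
  have same: "sector (\<alpha> + snd b) (f b) = f b" for b
    by (rule fock_eqI_sector) (metis assms sector_sector)
  show "sector (\<alpha> + \<beta>) (fock_extend f v) = fock_extend f (sector \<beta> v)"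
    by (rule fock_linear_eqI[OF fock_linear_compose[OF sector_linear fock_extend_linear]
          fock_linear_compose[OF fock_extend_linear sector_linear]])
      (use assms same in \<open>auto simp: fock.linear_0[OF fock_extend_linear]\<close>)
qed

lemma shift_op_compose: "shift_op \<alpha> S \<Longrightarrow> shift_op \<beta> T \<Longrightarrow> shift_op (\<alpha> + \<beta>) (\<lambda>v. S (T v))"
  unfolding shift_op_def
  by (auto simp: add.assoc intro: Vector_Spaces.linear_compose[unfolded o_def])

lemma shift_op_compose_0: "shift_op 0 S \<Longrightarrow> shift_op \<alpha> T \<Longrightarrow> shift_op \<alpha> (\<lambda>v. S (T v))"
  using shift_op_compose[of 0 S \<alpha> T] by simp

lemma shift_op_compose_0': "shift_op \<alpha> S \<Longrightarrow> shift_op 0 T \<Longrightarrow> shift_op \<alpha> (\<lambda>v. S (T v))"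
  using shift_op_compose[of \<alpha> S 0 T] by simp

lemma shift_op_id: "shift_op 0 (\<lambda>v. v)"
  by (auto simp: shift_op_def intro: fock_linearI)

lemma shift_op_zero: "shift_op \<alpha> (\<lambda>v. 0)"
  by (auto simp: shift_op_def intro: fock_linearI)

lemma shift_op_add: "shift_op \<alpha> S \<Longrightarrow> shift_op \<alpha> T \<Longrightarrow> shift_op \<alpha> (\<lambda>v. S v + T v)"
  by (auto simp: shift_op_def intro: fock.linear_compose_add)

lemma shift_op_scaled: "shift_op \<alpha> T \<Longrightarrow> shift_op \<alpha> (\<lambda>v. fock_scale c (T v))"
  by (auto simp: shift_op_def intro: fock.linear_compose_scale_right)

lemma shift_op_sum: "(\<And>a. a \<in> A \<Longrightarrow> shift_op \<alpha> (g a)) \<Longrightarrow> shift_op \<alpha> (\<lambda>v. \<Sum>a\<in>A. g a v)"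
  by (induction A rule: infinite_finite_induct) (auto intro: shift_op_zero shift_op_add)

lemma shift_op_funpow: "shift_op 0 T \<Longrightarrow> shift_op 0 (T ^^ j)"
  by (induction j) (auto simp: id_def o_def intro: shift_op_id shift_op_compose_0)

lemma shift_op_Sum_any:
  assumes "\<And>a. shift_op \<alpha> (g a)" "\<And>v. finite {a. g a v \<noteq> 0}"
  shows "shift_op \<alpha> (\<lambda>v. Sum_any (\<lambda>a. g a v))"
  using assms linear_Sum_any[OF sector_linear assms(2)]
  by (auto simp: shift_op_def intro!: linear_combination_Sum_any)

section \<open>Degree bounds and truncation\<close>

text \<open>The pair (i, r) stands for e_i(-r-1), of weight r + 1. This is the L(0)-weight without
  the summand \<langle>\<alpha>,\<alpha>\<rangle>/2, so it is always a natural number.\<close>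

definition fock_degree :: "('n \<times> nat) multiset \<Rightarrow> nat" where
  "fock_degree M = (\<Sum>(i, r)\<in>#M. Suc r)"

text \<open>The bound is an integer so that lowering it repeatedly may make it negative, which
  forces the vector to be 0.\<close>

definition degree_le :: "int \<Rightarrow> 'n::finite fock \<Rightarrow> bool" where
  "degree_le d v \<longleftrightarrow> (\<forall>b\<in>Poly_Mapping.keys v. int (fock_degree (fst b)) \<le> d)"

lemma degree_le_zero [simp]: "degree_le d 0"
  by (simp add: degree_le_def)

lemma degree_le_single: "int (fock_degree (fst b)) \<le> d \<Longrightarrow> degree_le d (Poly_Mapping.single b c)"
  by (simp add: degree_le_def)

lemma degree_le_scale: "degree_le d v \<Longrightarrow> degree_le d (fock_scale c v)"
  by (auto simp: degree_le_def in_keys_iff)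

lemma degree_le_add: "degree_le d u \<Longrightarrow> degree_le d v \<Longrightarrow> degree_le d (u + v)"
  unfolding degree_le_def using Poly_Mapping.keys_add[of u v] by blast

lemma degree_le_sum: "(\<And>a. a \<in> A \<Longrightarrow> degree_le d (f a)) \<Longrightarrow> degree_le d (sum f A)"
  by (induction A rule: infinite_finite_induct) (auto intro: degree_le_add)

lemma degree_le_extend:
  assumes "\<And>M \<alpha>. (M, \<alpha>) \<in> Poly_Mapping.keys v \<Longrightarrow> degree_le d (f (M, \<alpha>))"
  shows "degree_le d (fock_extend f v)"
  unfolding fock_extend_def using assms by (intro degree_le_sum degree_le_scale) auto

lemma degree_le_negative: "degree_le d v \<Longrightarrow> d < 0 \<Longrightarrow> v = 0"
  unfolding degree_le_def by (metis keys_eq_empty ex_in_conv linorder_not_less of_nat_0_le_iff order.trans)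

lemma degree_le_exists: "\<exists>d. degree_le d v"
proof
  show "degree_le (\<Sum>b\<in>Poly_Mapping.keys v. int (fock_degree (fst b))) v"
    unfolding degree_le_def by (auto intro!: member_le_sum)
qed

lemma fock_degree_remove:
  assumes "count M (i, r) \<noteq> 0"
  shows "int (fock_degree (M - {#(i, r)#})) = int (fock_degree M) - int (Suc r)"
proof -
  have "(i, r) \<in># M" using assms by (simp add: count_eq_zero_iff)
  then obtain N where "M = add_mset (i, r) N" by (metis insert_DiffM)
  then show ?thesis by (simp add: fock_degree_def)
qed

text \<open>An annihilation operator h(j) removes one variable e_i(-j), of degree j. If that
  variable is absent, the multiset difference removes nothing, but the factor \<open>count\<close>
  is 0.\<close>

lemma heis_degree:
  assumes "0 < j" "degree_le d v"
  shows "degree_le (d - int j) (heis B h (int j) v)"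
proof -
  have "degree_le (d - int j) (Poly_Mapping.single (M - {#(i, j - 1)#}, \<alpha>)
      (c * of_nat (count M (i, j - 1))))"
    if b: "(M, \<alpha>) \<in> Poly_Mapping.keys v" for M \<alpha> i and c :: complex
  proof (cases "count M (i, j - 1) = 0")
    case False
    then show ?thesis
      using b assms fock_degree_remove[of M i "j - 1"]
      by (intro degree_le_single) (auto simp: degree_le_def)
  qed simp
  then show ?thesis
    using assms unfolding heis_def by (intro degree_le_extend) (auto intro!: degree_le_sum)
qed

lemma heis_shift: "shift_op 0 (heis B h n)"
  unfolding heis_def by (rule shift_op_extend) auto

lemma heis_truncation: "\<forall>\<^sub>F n::int in at_top. heis B h n v = 0"
proof -
  obtain d where d: "degree_le d v" using degree_le_exists by blast
  have "heis B h n v = 0" if n: "max 1 (d + 1) \<le> n" for n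
  proof -
    have "degree_le (d - n) (heis B h n v)"
      using heis_degree[OF _ d, of "nat n"] n by simp
    then show ?thesis using n by (intro degree_le_negative[of "d - n"]) auto
  qed
  then show ?thesis unfolding eventually_at_top_linorder by blast
qed

lemma series_power_shift:
  assumes "\<And>j. shift_op 0 (A j)"
  shows "shift_op 0 (series_power A k N)"
proof (induction k arbitrary: N)
  case 0
  have "series_power A 0 N = (\<lambda>v. if N = 0 then v else 0)"
    by (simp add: fun_eq_iff)
  then show ?case by (cases "N = 0") (simp_all add: shift_op_id shift_op_zero)
next
  case (Suc k)
  have "series_power A (Suc k) N = (\<lambda>v. \<Sum>j=1..N. A j (series_power A k (N - j) v))"
    by (simp add: fun_eq_iff)
  then show ?case
    using shift_op_compose_0[OF assms Suc] by (simp only:) (rule shift_op_sum)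
qed

lemma series_exp_shift:
  assumes "\<And>j. shift_op 0 (A j)"
  shows "shift_op 0 (series_exp A N)"
proof -
  have "series_exp A N = (\<lambda>v. \<Sum>k\<le>N. fock_scale (1 / fact k) (series_power A k N v))"
    by (simp add: fun_eq_iff series_exp_def)
  then show ?thesis
    by (simp only:) (intro shift_op_sum shift_op_scaled series_power_shift assms)
qed

lemma E_minus_shift: "shift_op 0 (E_minus B \<alpha> p)"
  and E_plus_shift: "shift_op 0 (E_plus B \<alpha> p)"
  unfolding E_minus_def E_plus_def
  by (rule series_exp_shift, rule shift_op_scaled, rule heis_shift)+

text \<open>The indices of the factors add up to N, so the total drop is N whatever the exponent k
  is. Hence the bound survives summation over k in the exponential.\<close>

lemma series_power_degree:
  assumes A: "\<And>j d v. 0 < j \<Longrightarrow> degree_le d v \<Longrightarrow> degree_le (d - int j) (A j v)"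
    and v: "degree_le d v"
  shows "degree_le (d - int N) (series_power A k N v)"
proof (induction k arbitrary: N)
  case (Suc k)
  have "degree_le (d - int N) (A j (series_power A k (N - j) v))" if "j \<in> {1..N}" for j
    using A[OF _ Suc[of "N - j"], of j] that by (simp add: of_nat_diff)
  then show ?case by (auto intro: degree_le_sum)
qed (use v in auto)

lemma E_plus_truncation: "\<exists>Q. \<forall>q\<ge>Q. E_plus B \<alpha> q v = 0"
proof -
  obtain d where d: "degree_le d v" using degree_le_exists by blast
  have deg: "degree_le (d - int q) (E_plus B \<alpha> q v)" for q
    unfolding E_plus_def series_exp_def
    by (intro degree_le_sum degree_le_scale series_power_degree heis_degree d)
  have "E_plus B \<alpha> q v = 0" if "q \<ge> nat (d + 1)" for q
    using that by (intro degree_le_negative[OF deg]) linarith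
  then show ?thesis by blast
qed

lemma e_op_shift: "shift_op \<alpha> (e_op \<epsilon> \<alpha>)"
  unfolding e_op_def by (rule shift_op_extend) auto

section \<open>Fields: sector shift and truncation of the modes\<close>

text \<open>The invariant for the recursion of \<open>word_mode\<close>: truncation, with a bound
  depending on the vector, makes the sums in normally ordered products finite and is itself
  inherited by them.\<close>

definition fock_field :: "complex^'n \<Rightarrow> (int \<Rightarrow> 'n::finite fock \<Rightarrow> 'n fock) \<Rightarrow> bool" where
  "fock_field \<alpha> A \<longleftrightarrow> (\<forall>n. shift_op \<alpha> (A n)) \<and> (\<forall>v. \<forall>\<^sub>F n in at_top. A n v = 0)"

lemma truncation_extend:
  assumes "\<And>b. b \<in> Poly_Mapping.keys v \<Longrightarrow> \<forall>\<^sub>F n::int in at_top. f n b = 0"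
  shows "\<forall>\<^sub>F n in at_top. fock_extend (f n) v = 0"
proof -
  have "\<forall>\<^sub>F n in at_top. \<forall>b\<in>Poly_Mapping.keys v. f n b = 0"
    using assms by (intro eventually_ball_finite) auto
  then show ?thesis
    by eventually_elim (simp add: fock_extend_def)
qed

text \<open>No finiteness is assumed, because a sum with infinite support is 0 by default.\<close>

lemma sector_Sum_any_eq_0:
  assumes "\<And>a. sector \<beta> (f a) = 0"
  shows "sector \<beta> (Sum_any f) = 0"
proof (cases "finite {a. f a \<noteq> 0}")
  case True
  then show ?thesis by (simp add: linear_Sum_any[OF sector_linear] assms)
next
  case False
  then show ?thesis by simp
qed

lemma exp_mode_field: "fock_field \<alpha> (exp_mode B \<epsilon> \<alpha>)"
  unfolding fock_field_def
proof (intro conjI allI)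
  fix n
  have "sector \<delta> (E_minus B \<alpha> p (E_plus B \<alpha> q (e_op \<epsilon> \<alpha> (Poly_Mapping.single (M, \<beta>) 1)))) = 0"
    if "\<delta> \<noteq> \<alpha> + \<beta>" for M \<beta> \<delta> p q
  proof -
    have "shift_op \<alpha> (\<lambda>v. E_minus B \<alpha> p (E_plus B \<alpha> q (e_op \<epsilon> \<alpha> v)))"
      by (rule shift_op_compose_0[OF E_minus_shift shift_op_compose_0[OF E_plus_shift e_op_shift]])
    then have "sector \<delta> (E_minus B \<alpha> p (E_plus B \<alpha> q (e_op \<epsilon> \<alpha> (Poly_Mapping.single (M, \<beta>) 1)))) =
        E_minus B \<alpha> p (E_plus B \<alpha> q (e_op \<epsilon> \<alpha> (sector (\<delta> - \<alpha>) (Poly_Mapping.single (M, \<beta>) 1))))"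
      by (rule shift_op_sector')
    moreover have "\<beta> \<noteq> \<delta> - \<alpha>" using that by auto
    ultimately show ?thesis
      by (simp add: shift_op_0[OF E_minus_shift] shift_op_0[OF E_plus_shift] shift_op_0[OF e_op_shift])
  qed
  then show "shift_op \<alpha> (exp_mode B \<epsilon> \<alpha> n)"
    unfolding exp_mode_def
    by (intro shift_op_extend) (auto simp: Let_def intro!: sector_Sum_any_eq_0)
next
  fix v
  have "\<forall>\<^sub>F n in at_top. Sum_any (\<lambda>q::nat.
       let d = \<lfloor>Re (B \<alpha> \<beta>)\<rfloor>; p = int q - d - n - 1 in
       if p < 0 then 0
       else E_minus B \<alpha> (nat p) (E_plus B \<alpha> q (e_op \<epsilon> \<alpha> (Poly_Mapping.single (M, \<beta>) 1)))) = 0"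
    for M \<beta>
  proof -
    let ?x = "e_op \<epsilon> \<alpha> (Poly_Mapping.single (M, \<beta>) 1)" and ?d = "\<lfloor>Re (B \<alpha> \<beta>)\<rfloor>"
    obtain Q where Q: "\<And>q. q \<ge> Q \<Longrightarrow> E_plus B \<alpha> q ?x = 0"
      using E_plus_truncation by blast
    \<comment> \<open>A summand with p \<ge> 0 has q \<ge> d + n + 1 > Q, so \<open>E_plus\<close>
      already kills it.\<close>
    have "(if int q - ?d - n - 1 < 0 then 0
        else E_minus B \<alpha> (nat (int q - ?d - n - 1)) (E_plus B \<alpha> q ?x)) = 0"
      if "n \<ge> int Q - ?d" for q n
      using that Q[of q] by (auto simp: shift_op_0[OF E_minus_shift])
    then have "Sum_any (\<lambda>q::nat. if int q - ?d - n - 1 < 0 then 0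
        else E_minus B \<alpha> (nat (int q - ?d - n - 1)) (E_plus B \<alpha> q ?x)) = 0"
      if "n \<ge> int Q - ?d" for n
      using that by simp
    then show ?thesis
      unfolding Let_def eventually_at_top_linorder by blast
  qed
  then show "\<forall>\<^sub>F n in at_top. exp_mode B \<epsilon> \<alpha> n v = 0"
    unfolding exp_mode_def by (intro truncation_extend) auto
qed

text \<open>For m < 0 the mode of A acts first, and its index grows as m decreases; for m \<ge> 0
  the operator h(m) acts first and vanishes for large m. So only finitely many m contribute to each
  mode.\<close>

lemma normal_ordered_field:
  assumes A: "fock_field \<alpha> A"
  shows "fock_field \<alpha> (normal_ordered B h r A)"
proof -
  have shift: "shift_op \<alpha> (A n)" for n
    using A by (simp add: fock_field_def)
  note zero = shift_op_0[OF heis_shift[of B h]] shift_op_0[OF shift]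
  define g where "g n m v = fock_scale (of_int (- m - 1) gchoose r)
       (if m < 0 then heis B h m (A (n - m - int r - 1) v)
        else A (n - m - int r - 1) (heis B h m v))" for n m v
  have no: "normal_ordered B h r A n = (\<lambda>v. Sum_any (\<lambda>m. g n m v))" for n
    by (simp add: fun_eq_iff normal_ordered_def g_def)
  obtain H where H: "\<And>v m. m \<ge> H v \<Longrightarrow> heis B h m v = 0"
    using heis_truncation[of B h] unfolding eventually_at_top_linorder by metis
  obtain K where K: "\<And>v n. n \<ge> K v \<Longrightarrow> A n v = 0"
    using A unfolding fock_field_def eventually_at_top_linorder by metis
  have "shift_op \<alpha> (g n m)" for n m
    unfolding g_def
    using shift_op_compose_0[OF heis_shift shift] shift_op_compose_0'[OF shift heis_shift]
    by (cases "m < 0") (auto intro!: shift_op_scaled)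
  moreover have "finite {m. g n m v \<noteq> 0}" for n v
  proof (rule finite_subset)
    have "min 0 (n - int r - 1 - K v) \<le> m \<and> m \<le> max 0 (H v)" if "g n m v \<noteq> 0" for m
    proof (cases "m < 0")
      case True
      then have "A (n - m - int r - 1) v \<noteq> 0"
        using that by (auto simp: g_def zero(1))
      then have "\<not> K v \<le> n - m - int r - 1"
        using K by blast
      then show ?thesis using True by linarith
    next
      case False
      then have "heis B h m v \<noteq> 0"
        using that by (auto simp: g_def zero(2))
      then have "\<not> H v \<le> m" using H by blast
      then show ?thesis using False by linarith
    qed
    then show "{m. g n m v \<noteq> 0} \<subseteq> {min 0 (n - int r - 1 - K v)..max 0 (H v)}"
      by auto
  qed simp
  moreover have "\<forall>\<^sub>F n in at_top. Sum_any (\<lambda>m. g n m v) = 0" for v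
  proof -
    \<comment> \<open>Only finitely many vectors h(m)v with m \<ge> 0 are nonzero, so one truncation
      bound serves them all.\<close>
    have "\<forall>\<^sub>F n in at_top. \<forall>m\<in>{0..<H v}. A n (heis B h m v) = 0"
      using A by (intro eventually_ball_finite) (auto simp: fock_field_def)
    then obtain N where N: "\<And>n m. n \<ge> N \<Longrightarrow> m \<in> {0..<H v} \<Longrightarrow> A n (heis B h m v) = 0"
      unfolding eventually_at_top_linorder by blast
    \<comment> \<open>The bound keeps the index n - m - r - 1 of A above K v when m < 0, and above N
      when 0 \<le> m < H v.\<close>
    have "g n m v = 0" if "n \<ge> max (K v) (N + \<bar>H v\<bar>) + int r + 1" for n m
    proof (cases "m < 0")
      case True
      then have "A (n - m - int r - 1) v = 0" using that by (intro K) linarith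
      then show ?thesis using True by (simp add: g_def zero(1))
    next
      case False
      have "A (n - m - int r - 1) (heis B h m v) = 0"
      proof (cases "m < H v")
        case True
        then show ?thesis using False that by (intro N) auto
      next
        case False
        then have "heis B h m v = 0" by (intro H) simp
        then show ?thesis by (simp add: zero(2))
      qed
      then show ?thesis using False by (simp add: g_def)
    qed
    then have "Sum_any (\<lambda>m. g n m v) = 0" if "n \<ge> max (K v) (N + \<bar>H v\<bar>) + int r + 1" for n
      using that by simp
    then show ?thesis unfolding eventually_at_top_linorder by blast
  qed
  ultimately show ?thesis
    unfolding fock_field_def no by (auto intro: shift_op_Sum_any)
qed

lemma word_mode_field: "fock_field \<alpha> (word_mode B \<epsilon> ws \<alpha>)"
  by (induction ws) (auto intro: exp_mode_field normal_ordered_field)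

lemma word_mode_shift: "shift_op \<alpha> (word_mode B \<epsilon> ws \<alpha> n)"
  and word_mode_truncation: "\<forall>\<^sub>F n in at_top. word_mode B \<epsilon> ws \<alpha> n v = 0"
  by (rule word_mode_field[unfolded fock_field_def, THEN conjunct1, rule_format],
      rule word_mode_field[unfolded fock_field_def, THEN conjunct2, rule_format])

section \<open>Modes of arbitrary vectors\<close>

text \<open>With n and v fixed, the chosen enumeration depends on the basis vector alone, so the
  mode is a linear extension in u; linearity and truncation follow from this form.\<close>

lemma lattice_mode_eq_extend:
  "lattice_mode B \<epsilon> u n v =
     fock_extend (\<lambda>(M, \<alpha>). word_mode B \<epsilon> (SOME ws. mset ws = M) \<alpha> n v) u"
  unfolding lattice_mode_def fock_extend_def by (rule sum.cong) auto

lemma lattice_mode_linear: "fock_linear (\<lambda>u. lattice_mode B \<epsilon> u n v)"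
  unfolding lattice_mode_eq_extend by (rule fock_extend_linear)

lemma lattice_mode_single:
  "lattice_mode B \<epsilon> (Poly_Mapping.single (M, \<alpha>) c) n v =
     fock_scale c (word_mode B \<epsilon> (SOME ws. mset ws = M) \<alpha> n v)"
  by (simp add: lattice_mode_eq_extend)

lemma lattice_mode_truncation: "\<forall>\<^sub>F n in at_top. lattice_mode B \<epsilon> u n v = 0"
  unfolding lattice_mode_eq_extend
  by (rule truncation_extend) (auto intro: word_mode_truncation)

lemma lattice_mode_shift:
  assumes "\<And>b. b \<in> Poly_Mapping.keys u \<Longrightarrow> snd b = \<alpha>"
  shows "shift_op \<alpha> (lattice_mode B \<epsilon> u n)"
proof -
  have "lattice_mode B \<epsilon> u n = (\<lambda>v. \<Sum>b\<in>Poly_Mapping.keys u. fock_scale (Poly_Mapping.lookup u b)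
      (word_mode B \<epsilon> (SOME ws. mset ws = fst b) (snd b) n v))"
    by (simp add: fun_eq_iff lattice_mode_def case_prod_unfold)
  then show ?thesis
    by (simp only:) (rule shift_op_sum, rule shift_op_scaled, metis assms word_mode_shift)
qed

section \<open>Nondegeneracy of the form\<close>

lemma even_lattice_linear:
  assumes "even_lattice B L0"
  shows "Vector_Spaces.linear (*s) (*) (B x)" "Vector_Spaces.linear (*s) (*) (\<lambda>x. B x y)"
    and "B x y = B y x"
  using assms by (auto simp: even_lattice_def)

lemma vec_linear_expand:
  fixes f :: "complex^'n \<Rightarrow> complex"
  assumes "Vector_Spaces.linear (*s) (*) f"
  shows "f (\<Sum>a\<in>A. c a *s v a) = (\<Sum>a\<in>A. c a * f (v a))" and "f 0 = 0" and "f (u + u') = f u + f u'"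
proof -
  interpret f: Vector_Spaces.linear "(*s)" "(*)" f by fact
  show "f (\<Sum>a\<in>A. c a *s v a) = (\<Sum>a\<in>A. c a * f (v a))" "f 0 = 0" "f (u + u') = f u + f u'"
    by (simp_all add: f.sum f.scale f.add f.zero)
qed

lemmas even_lattice_expand =
  vec_linear_expand[OF even_lattice_linear(1)] vec_linear_expand[OF even_lattice_linear(2)]

lemma basis_expansion_axis: "x = (\<Sum>i\<in>UNIV. (x $ i) *s axis i (1::complex))"
  by (simp add: vec_eq_iff axis_def if_distrib cong: if_cong)

text \<open>
  The Gram matrix of a \<open>\<int>\<close>-basis has a trivial kernel over \<open>\<rat>\<close>, because a rational kernel
  vector can be scaled to an element of \<open>L0\<close> of norm zero. Its rational left inverse is
  also a left inverse over \<open>\<complex>\<close>.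
\<close>

lemma even_lattice_nondegenerate_span:
  fixes B :: "complex^'n \<Rightarrow> complex^'n \<Rightarrow> complex"
  assumes lat: "even_lattice B L0" and y: "\<And>x. B x y = 0"
  shows "y = 0"
proof -
  note expand = even_lattice_expand[OF lat]
  obtain S where S: "vec.independent S" "vec.span S = UNIV"
    and L0: "L0 = {\<Sum>b\<in>S. of_int (z b) *s b | z. True}"
    using lat unfolding even_lattice_def by blast
  have fin: "finite S" using S(1) by (rule vec.finiteI_independent)
  \<comment> \<open>The lattice basis is indexed by the type \<open>'n\<close> itself, so that its
    Gram matrix has a matrix type.\<close>
  have "card S = CARD('n)"
    using vec.dim_eq_card[of S UNIV] S by (simp add: vec.span_UNIV card_cart_basis)
  then obtain s :: "'n \<Rightarrow> complex^'n" where s: "bij_betw s UNIV S"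
    using finite_same_card_bij[of "UNIV::'n set" S] fin by auto
  have sum_S: "(\<Sum>b\<in>S. f b) = (\<Sum>i\<in>UNIV. f (s i))" for f :: "complex^'n \<Rightarrow> complex^'n"
    using sum.reindex_bij_betw[OF s, of f] by simp
  have in_L0: "(\<Sum>i\<in>UNIV. of_int (z i) *s s i) \<in> L0" for z
  proof -
    have "(\<Sum>i\<in>UNIV. of_int (z i) *s s i) = (\<Sum>b\<in>S. of_int (z (inv_into UNIV s b)) *s b)"
      using s by (simp add: sum_S bij_betw_def)
    then show ?thesis unfolding L0 by (intro CollectI exI[of _ "\<lambda>b. z (inv_into UNIV s b)"]) simp
  qed
  have indep: "c i = 0" if "(\<Sum>i\<in>UNIV. c i *s s i) = 0" for c i
  proof -
    have "(\<Sum>b\<in>S. c (inv_into UNIV s b) *s b) = 0"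
      using s that by (simp add: sum_S bij_betw_def)
    then have "c (inv_into UNIV s (s i)) = 0"
      using s by (intro vec.independentD[OF S(1) fin order.refl]) (auto simp: bij_betw_def)
    then show ?thesis using s by (simp add: bij_betw_def)
  qed
  have "s i \<in> L0" for i
    using in_L0[of "\<lambda>j. if j = i then 1 else 0"] by (simp add: if_distrib if_distribR cong: if_cong)
  then have "B (s i) (s j) \<in> \<int>" for i j
    using lat by (auto simp: even_lattice_def)
  then have "\<exists>k. B (s i) (s j) = of_int k" for i j
    by (auto elim!: Ints_cases)
  then obtain g where g: "\<And>i j. B (s i) (s j) = of_int (g i j)" by metis
  \<comment> \<open>The integral Gram matrix of the lattice basis, read over the rationals so that
    denominators of kernel vectors can be cleared.\<close>
  define Q :: "rat^'n^'n" where "Q = (\<chi> i j. of_int (g i j))"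
  have ker: "x = 0" if Qx: "Q *v x = 0" for x
  proof -
    \<comment> \<open>A common denominator of all coordinates of x.\<close>
    define D where "D = (\<Prod>i\<in>UNIV. snd (quotient_of (x $ i)))"
    have D: "D > 0" unfolding D_def by (intro prod_pos) (auto simp: quotient_of_denom_pos')
    have "\<exists>k::int. of_int D * x $ i = of_int k" for i
    proof -
      obtain m where m: "D = snd (quotient_of (x $ i)) * m"
        unfolding D_def by (metis dvdE dvd_prodI finite UNIV_I)
      have "x $ i = of_int (fst (quotient_of (x $ i))) / of_int (snd (quotient_of (x $ i)))"
        by (metis prod.collapse quotient_of_div)
      moreover have "snd (quotient_of (x $ i)) \<noteq> 0"
        using quotient_of_denom_pos'[of "x $ i"] by linarith
      ultimately have "of_int (snd (quotient_of (x $ i))) * x $ i = of_int (fst (quotient_of (x $ i)))"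
        by (metis nonzero_mult_div_cancel_left of_int_eq_0_iff times_divide_eq_right)
      then have "of_int D * x $ i = of_int (fst (quotient_of (x $ i)) * m)"
        by (simp add: m mult_ac)
      then show ?thesis by blast
    qed
    then obtain z where z: "\<And>i. of_int D * x $ i = of_int (z i)" by metis
    have gz: "(\<Sum>j\<in>UNIV. g i j * z j) = 0" for i
    proof -
      have "(of_int (\<Sum>j\<in>UNIV. g i j * z j) :: rat) = of_int D * (\<Sum>j\<in>UNIV. Q $ i $ j * x $ j)"
        by (simp add: Q_def sum_distrib_left z[symmetric] mult_ac)
      also have "\<dots> = 0"
        using arg_cong[OF Qx, of "\<lambda>v. v $ i"] by (simp add: matrix_vector_mult_def)
      finally show ?thesis by (simp only: of_int_eq_0_iff)
    qed
    let ?\<alpha> = "\<Sum>i\<in>UNIV. of_int (z i) *s s i"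
    \<comment> \<open>The norm of the scaled kernel vector is the quadratic form of \<open>g\<close>
      at \<open>z\<close>, which is 0 by \<open>gz\<close>; positivity then gives the zero lattice
      vector.\<close>
    have "B ?\<alpha> ?\<alpha> = (\<Sum>i\<in>UNIV. of_int (z i) * (\<Sum>j\<in>UNIV. of_int (z j) * B (s i) (s j)))"
      by (simp only: expand(4)) (simp only: expand(1))
    also have "\<dots> = (\<Sum>i\<in>UNIV. of_int (z i) * of_int (\<Sum>j\<in>UNIV. g i j * z j))"
      by (simp add: g mult.commute)
    also have "\<dots> = 0" by (simp add: gz del: of_int_sum)
    finally have "?\<alpha> = 0"
      using lat in_L0[of z] unfolding even_lattice_def by fastforce
    then have "z i = 0" for i using indep[of "\<lambda>i. of_int (z i)" i] by simp
    then show ?thesis using z D by (simp add: vec_eq_iff)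
  qed
  then have "\<exists>Q'. Q' ** Q = mat 1"
    unfolding matrix_left_invertible_ker by simp
  then obtain Q' where Q': "Q' ** Q = mat 1" by (elim exE)
  have "y \<in> vec.span S" using S by simp
  then obtain c where "y = (\<Sum>b\<in>S. c b *s b)"
    unfolding vec.span_finite[OF fin] by blast
  then have c: "y = (\<Sum>k\<in>UNIV. c (s k) *s s k)" by (simp add: sum_S)
  have "c (s i) = 0" for i
  proof -
    have inv: "(\<Sum>j\<in>UNIV. of_rat (Q' $ i $ j) * of_int (g j k)) = (if i = k then 1 else 0 :: complex)" for k
    proof -
      have "(\<Sum>j\<in>UNIV. of_rat (Q' $ i $ j) * of_int (g j k)) =
          (of_rat (\<Sum>j\<in>UNIV. Q' $ i $ j * Q $ j $ k) :: complex)"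
        by (simp add: of_rat_sum of_rat_mult Q_def)
      also have "(\<Sum>j\<in>UNIV. Q' $ i $ j * Q $ j $ k) = (Q' ** Q) $ i $ k"
        by (simp add: matrix_matrix_mult_def)
      finally show ?thesis by (simp add: Q' mat_def)
    qed
    \<comment> \<open>Applying the rational left inverse to the vanishing pairings with the basis
      recovers the complex coordinates of y.\<close>
    have "0 = (\<Sum>j\<in>UNIV. of_rat (Q' $ i $ j) * B (s j) y)" by (simp add: y)
    also have "\<dots> = (\<Sum>j\<in>UNIV. \<Sum>k\<in>UNIV. c (s k) * (of_rat (Q' $ i $ j) * of_int (g j k)))"
      unfolding c by (simp add: expand(1) g sum_distrib_left mult_ac)
    also have "\<dots> = (\<Sum>k\<in>UNIV. c (s k) * (\<Sum>j\<in>UNIV. of_rat (Q' $ i $ j) * of_int (g j k)))"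
      by (subst sum.swap) (simp add: sum_distrib_left)
    also have "\<dots> = c (s i)" by (simp add: inv if_distrib cong: if_cong)
    finally show ?thesis by simp
  qed
  then show ?thesis by (simp add: c)
qed

lemma even_lattice_nondegenerate:
  assumes lat: "even_lattice B L0" and y: "\<And>i. B (axis i 1) y = 0"
  shows "y = 0"
proof (rule even_lattice_nondegenerate_span[OF lat])
  fix x
  have "B x y = (\<Sum>i\<in>UNIV. x $ i * B (axis i 1) y)"
    by (subst (1) basis_expansion_axis) (simp add: even_lattice_expand(4)[OF lat])
  then show "B x y = 0" by (simp add: y)
qed

section \<open>The Gram matrix of the e_i, and the coset of \<gamma>\<close>

definition gram :: "(complex^'n \<Rightarrow> complex^'n \<Rightarrow> complex) \<Rightarrow> complex^'n^'n" where
  "gram B = (\<chi> i j. B (axis i 1) (axis j 1))"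

text \<open>A kernel vector is orthogonal to every e_i, hence 0; a left inverse of a square matrix
  is two-sided. As \<open>matrix_inv\<close> is a choice, an inverse must be exhibited before its
  equations can be used.\<close>

lemma gram_invertible:
  assumes lat: "even_lattice B L0"
  shows "gram B ** matrix_inv (gram B) = mat 1" "matrix_inv (gram B) ** gram B = mat 1"
proof -
  have "x = 0" if "gram B *v x = 0" for x
  proof (rule even_lattice_nondegenerate[OF lat])
    fix i
    have "B (axis i 1) x = (\<Sum>j\<in>UNIV. x $ j * B (axis i 1) (axis j 1))"
      by (subst (1) basis_expansion_axis) (simp add: even_lattice_expand(1)[OF lat])
    also have "\<dots> = (gram B *v x) $ i"
      by (simp add: gram_def matrix_vector_mult_def mult.commute)
    finally show "B (axis i 1) x = 0" by (simp add: that)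
  qed
  then have "\<exists>A. A ** gram B = mat 1"
    unfolding matrix_left_invertible_ker by simp
  then have "\<exists>A. gram B ** A = mat 1 \<and> A ** gram B = mat 1"
    by (metis matrix_left_right_inverse)
  then have "gram B ** matrix_inv (gram B) = mat 1 \<and> matrix_inv (gram B) ** gram B = mat 1"
    unfolding matrix_inv_def by (rule someI_ex)
  then show "gram B ** matrix_inv (gram B) = mat 1" "matrix_inv (gram B) ** gram B = mat 1"
    by auto
qed

lemma even_lattice_group:
  assumes lat: "even_lattice B L0"
  shows "0 \<in> L0" "x \<in> L0 \<Longrightarrow> y \<in> L0 \<Longrightarrow> x - y \<in> L0" "L0 \<subseteq> dual_lattice B L0"
proof -
  obtain S where L0: "L0 = {\<Sum>b\<in>S. of_int (z b) *s b | z. True}"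
    using lat unfolding even_lattice_def by blast
  show "0 \<in> L0"
    unfolding L0 by (rule CollectI, rule exI[of _ "\<lambda>_. 0"]) simp
  assume "x \<in> L0" "y \<in> L0"
  then obtain p q where "x = (\<Sum>b\<in>S. of_int (p b) *s b)" "y = (\<Sum>b\<in>S. of_int (q b) *s b)"
    unfolding L0 by blast
  then have "x - y = (\<Sum>b\<in>S. of_int ((\<lambda>b. p b - q b) b) *s b)"
    by (simp add: sum_subtractf vec.scale_left_diff_distrib)
  then show "x - y \<in> L0" unfolding L0 by (intro CollectI exI[of _ "\<lambda>b. p b - q b"]) simp
next
  show "L0 \<subseteq> dual_lattice B L0"
  proof -
    have "\<forall>\<alpha>\<in>L0. \<forall>\<beta>\<in>L0. B \<alpha> \<beta> \<in> \<int>"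
      using lat unfolding even_lattice_def by blast
    then show ?thesis by (auto simp: dual_lattice_def)
  qed
qed

text \<open>Places the values of F where \<epsilon> is normalized, so that modes of e_i(-1)1 act on
  them as Heisenberg operators.\<close>

lemma coset_subset_dual_lattice:
  assumes lat: "even_lattice B L0" and "\<gamma> \<in> dual_lattice B L0"
  shows "(+) \<gamma> ` L0 \<subseteq> dual_lattice B L0"
  using assms(2) even_lattice_group(3)[OF lat]
  by (auto simp: dual_lattice_def even_lattice_expand[OF lat] subset_iff)

section \<open>Modes of the generators and of the conformal vector\<close>

lemma series_exp_eq_id:
  assumes "\<And>j v. A j v = 0"
  shows "series_exp A N v = (if N = 0 then v else 0)"
proof -
  have "series_power A k N v = (if k = 0 \<and> N = 0 then v else 0)" for k
    by (cases k) (auto simp: assms)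
  then have "series_exp A N v = (\<Sum>k\<le>N. if k = 0 then (if N = 0 then v else 0) else 0)"
    unfolding series_exp_def by (intro sum.cong) auto
  then show ?thesis by simp
qed

lemma heis_zero:
  assumes "even_lattice B L0"
  shows "heis B 0 n v = 0"
proof -
  have "heis B 0 n = fock_extend (\<lambda>b. 0)"
    unfolding heis_def by (simp add: even_lattice_expand[OF assms] case_prod_unfold cong: if_cong)
  then show ?thesis by (simp add: fock_extend_def)
qed

text \<open>The modes of h = 0 vanish, so both exponentials reduce to their constant terms p = q =
  0, and p = -n-1 leaves n = -1. The restriction on v is due to \<epsilon>(0,\<beta>) = 1 being
  given on the dual lattice only.\<close>

lemma exp_mode_zero:
  assumes lat: "even_lattice B L0" and coc: "lattice_cocycle B L0 \<epsilon>"
    and v: "v \<in> fock_space (dual_lattice B L0)"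
  shows "exp_mode B \<epsilon> 0 n v = (if n = -1 then v else 0)"
proof (rule fock_linear_eqI[where S = "exp_mode B \<epsilon> 0 n" and T = "\<lambda>v. if n = -1 then v else 0"])
  show "fock_linear (exp_mode B \<epsilon> 0 n)"
    using exp_mode_field[of 0 B \<epsilon>] by (simp add: fock_field_def shift_op_def)
  show "fock_linear (\<lambda>v. if n = -1 then v else 0)"
    by (auto intro: fock_linearI)
  fix b assume b: "b \<in> Poly_Mapping.keys v"
  obtain M \<beta> where Mb: "b = (M, \<beta>)" by force
  have "\<beta> \<in> dual_lattice B L0" using b v by (auto simp: fock_space_def Mb)
  then have eps: "\<epsilon> 0 \<beta> = 1" using coc by (auto simp: lattice_cocycle_def Let_def)
  have E: "E_minus B 0 p u = (if p = 0 then u else 0)" "E_plus B 0 p u = (if p = 0 then u else 0)" for p u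
    unfolding E_minus_def E_plus_def by (rule series_exp_eq_id, simp add: heis_zero[OF lat])+
  have e: "e_op \<epsilon> 0 (Poly_Mapping.single (M, \<beta>) 1) = Poly_Mapping.single (M, \<beta>) 1"
    by (simp add: e_op_def eps)
  have "exp_mode B \<epsilon> 0 n (Poly_Mapping.single b 1) =
     Sum_any (\<lambda>q::nat. if int q - n - 1 < 0 then 0
       else E_minus B 0 (nat (int q - n - 1)) (E_plus B 0 q (Poly_Mapping.single b 1)))"
    by (simp add: exp_mode_def Mb Let_def e even_lattice_expand[OF lat] cong: if_cong)
  also have "\<dots> = Sum_any (\<lambda>q::nat. if n = -1 \<and> q = 0 then Poly_Mapping.single b 1 else 0)"
    by (rule Sum_any.cong) (auto simp: E)
  also have "\<dots> = (if n = -1 then Poly_Mapping.single b 1 else 0)"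
    by (cases "n = -1") simp_all
  finally show "exp_mode B \<epsilon> 0 n (Poly_Mapping.single b 1) =
      (if n = -1 then Poly_Mapping.single b 1 else 0)" .
qed

text \<open>The inner field is the identity field, whose only nonzero mode is -1; with r = 0 this
  selects m = n.\<close>

lemma word_mode_singleton:
  assumes lat: "even_lattice B L0" and coc: "lattice_cocycle B L0 \<epsilon>"
    and v: "v \<in> fock_space (dual_lattice B L0)"
  shows "word_mode B \<epsilon> [(i, 0)] 0 n v = heis B (axis i 1) n v"
proof -
  have hv: "heis B h m v \<in> fock_space (dual_lattice B L0)" for h m
    by (rule shift_op_fock_space[OF heis_shift v])
  have "word_mode B \<epsilon> [(i, 0)] 0 n v = Sum_any (\<lambda>m. if m = n then heis B (axis i 1) n v else 0)"
    unfolding word_mode.simps normal_ordered_def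
    by (rule Sum_any.cong)
      (auto simp: exp_mode_zero[OF lat coc] v hv shift_op_0[OF heis_shift])
  then show ?thesis by simp
qed

lemma heis_generator:
  assumes "0 < m"
  shows "heis B h m (Poly_Mapping.single ({#(k, 0)#}, 0) 1) =
    (if m = 1 then Poly_Mapping.single ({#}, 0) (B h (axis k 1)) else 0)"
proof -
  have "heis B h m (Poly_Mapping.single ({#(k, 0)#}, 0) 1) =
    (\<Sum>l\<in>UNIV. Poly_Mapping.single ({#(k, 0)#} - {#(l, nat m - 1)#}, 0)
       (of_int m * B h (axis l 1) * of_nat (count {#(k, 0)#} (l, nat m - 1))))"
    using assms unfolding heis_def fock_extend_single by (simp only: prod.case) simp
  also have "\<dots> = (\<Sum>l\<in>UNIV. if l = k then
       (if m = 1 then Poly_Mapping.single ({#}, 0) (B h (axis k 1)) else 0) else 0)"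
    using assms by (intro sum.cong) auto
  finally show ?thesis by simp
qed

lemma heis_creation_vacuum:
  "heis B (axis i 1) (- 1) (Poly_Mapping.single ({#}, 0) c) = Poly_Mapping.single ({#(i, 0)#}, 0) c"
proof -
  have "heis B (axis i 1) (- 1) (Poly_Mapping.single ({#}, 0) c) =
    (\<Sum>l\<in>UNIV. Poly_Mapping.single ({#(l, 0)#}, 0) (c * axis i 1 $ l))"
    by (simp add: heis_def fock.scale_sum_right)
  also have "\<dots> = (\<Sum>l\<in>UNIV. if l = i then Poly_Mapping.single ({#(i, 0)#}, 0) c else 0)"
    by (intro sum.cong) (auto simp: axis_def)
  finally show ?thesis by simp
qed

text \<open>\<open>lattice_mode\<close> enumerates a monomial by choice, so for the quadratic terms
  of \<omega> both orders must be considered.\<close>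

lemma mset_eq_pair:
  assumes "mset ws = {#a, b#}"
  shows "ws = [a, b] \<or> ws = [b, a]"
proof -
  have "length ws = 2" using assms by (metis size_mset size_add_mset size_empty numeral_2_eq_2)
  then obtain x y where "ws = [x, y]"
    by (auto simp: numeral_2_eq_2 length_Suc_conv)
  with assms show ?thesis by (auto simp: add_eq_conv_ex)
qed

lemma word_mode_pair_generator:
  assumes lat: "even_lattice B L0" and coc: "lattice_cocycle B L0 \<epsilon>"
  shows "word_mode B \<epsilon> [(i, 0), (j, 0)] 0 1 (Poly_Mapping.single ({#(k, 0)#}, 0) 1) =
    Poly_Mapping.single ({#(i, 0)#}, 0) (B (axis j 1) (axis k 1)) +
    Poly_Mapping.single ({#(j, 0)#}, 0) (B (axis i 1) (axis k 1))"
    (is "word_mode B \<epsilon> _ 0 1 ?u = ?s i j + ?s j i")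
proof -
  let ?h = "\<lambda>i. heis B (axis i 1)"
  have dual: "0 \<in> dual_lattice B L0"
    using even_lattice_group[OF lat] by blast
  then have u: "?u \<in> fock_space (dual_lattice B L0)" by (simp add: fock_space_def)
  have hu: "?h i m ?u \<in> fock_space (dual_lattice B L0)" for m
    by (rule shift_op_fock_space[OF heis_shift u])
  have h0: "?h i 0 ?u = 0" by (simp add: heis_def even_lattice_expand[OF lat])
  define f where "f m = (if m < 0 then ?h i m (?h j (- m) ?u) else ?h j (- m) (?h i m ?u))" for m
  have "word_mode B \<epsilon> [(i, 0), (j, 0)] 0 1 ?u = Sum_any f"
    unfolding word_mode.simps(2)[of _ _ i 0 "[(j, 0)]"] normal_ordered_def
    by (rule Sum_any.cong) (simp add: f_def word_mode_singleton[OF lat coc] u hu del: word_mode.simps cong: if_cong)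
  \<comment> \<open>In every summand the operator applied first has index \<bar>m\<bar>. It kills
    e_k(-1)1 when \<bar>m\<bar> > 1, and also when m = 0 because the vector lies in sector
    0.\<close>
  also have "\<dots> = (\<Sum>m\<in>{- 1, 1}. f m)"
  proof (rule Sum_any.expand_superset)
    have "f m = 0" if "m \<notin> {- 1, 1}" for m
    proof -
      consider "m < 0" | "m = 0" | "0 < m" by linarith
      then show ?thesis
        using that by cases (auto simp: f_def heis_generator h0 shift_op_0[OF heis_shift])
    qed
    then show "{m. f m \<noteq> 0} \<subseteq> {- 1, 1}" by blast
  qed simp
  also have "\<dots> = ?s i j + ?s j i"
    by (simp add: f_def heis_generator heis_creation_vacuum)
  finally show ?thesis .
qed

lemma sum_single: "(\<Sum>a\<in>A. Poly_Mapping.single b (f a)) = Poly_Mapping.single b (\<Sum>a\<in>A. f a)"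
  by (induction A rule: infinite_finite_induct) (auto simp: single_add)

text \<open>Contracting the inverse Gram matrix with the two pairings gives e_k(-1)1 twice with
  factor 1/2. Since F commutes with L(0), this suffices to make F(e_k(-1)1) a vector of weight
  one.\<close>

lemma conformal_weight_generator:
  assumes lat: "even_lattice B L0" and coc: "lattice_cocycle B L0 \<epsilon>"
  shows "lattice_mode B \<epsilon> (lattice_conformal B) 1 (Poly_Mapping.single ({#(k, 0)#}, 0) 1) =
    Poly_Mapping.single ({#(k, 0)#}, 0) 1"
    (is "lattice_mode B \<epsilon> _ 1 (?e k) = _")
proof -
  define G where "G = matrix_inv (gram B)"
  let ?s = "\<lambda>i c. Poly_Mapping.single ({#(i, 0)#}, 0) c :: 'a fock"
  let ?b = "\<lambda>i j. B (axis i 1) (axis j 1)"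
  have word: "word_mode B \<epsilon> (SOME ws. mset ws = {#(i, 0), (j, 0)#}) 0 1 (?e k) = ?s i (?b j k) + ?s j (?b i k)"
    for i j
  proof -
    define ws where "ws = (SOME ws. mset ws = {#(i, 0::nat), (j, 0)#})"
    have "mset ws = {#(i, 0), (j, 0)#}"
      unfolding ws_def by (rule someI_ex) (rule ex_mset)
    then have "ws = [(i, 0), (j, 0)] \<or> ws = [(j, 0), (i, 0)]"
      by (rule mset_eq_pair)
    then show ?thesis
      unfolding ws_def[symmetric]
      by (elim disjE) (simp_all only: word_mode_pair_generator[OF lat coc] add.commute)
  qed
  have left: "(\<Sum>j\<in>UNIV. G $ i $ j * ?b j k) = (if i = k then 1 else 0)" for i
    using arg_cong[OF gram_invertible(2)[OF lat], of "\<lambda>A. A $ i $ k"]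
    by (simp add: G_def gram_def matrix_matrix_mult_def mat_def)
  have right: "(\<Sum>i\<in>UNIV. G $ i $ j * ?b i k) = (if j = k then 1 else 0)" for j
    using arg_cong[OF gram_invertible(1)[OF lat], of "\<lambda>A. A $ k $ j"]
    by (auto simp: G_def gram_def matrix_matrix_mult_def mat_def mult.commute
        even_lattice_linear(3)[OF lat, of _ "axis k 1"])
  have "lattice_mode B \<epsilon> (lattice_conformal B) 1 (?e k) =
      (\<Sum>i\<in>UNIV. \<Sum>j\<in>UNIV. fock_scale (G $ i $ j / 2) (?s i (?b j k) + ?s j (?b i k)))"
    unfolding lattice_conformal_def Let_def gram_def[symmetric] G_def[symmetric]
    by (simp add: fock.linear_sum[OF lattice_mode_linear] lattice_mode_single word)
  \<comment> \<open>The second double sum is exchanged so that its inner sum, too, is an entry of a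
    product of the Gram matrix with its inverse.\<close>
  also have "\<dots> = (\<Sum>i\<in>UNIV. \<Sum>j\<in>UNIV. ?s i (G $ i $ j * ?b j k / 2)) +
      (\<Sum>j\<in>UNIV. \<Sum>i\<in>UNIV. ?s j (G $ i $ j * ?b i k / 2))"
    by (subst (3) sum.swap) (simp add: fock.scale_right_distrib sum.distrib)
  also have "\<dots> = (\<Sum>i\<in>UNIV. if i = k then ?s k (1 / 2) else 0) + (\<Sum>j\<in>UNIV. if j = k then ?s k (1 / 2) else 0)"
    by (intro arg_cong2[where f = "(+)"] sum.cong)
      (auto simp: sum_single sum_divide_distrib[symmetric] left right)
  also have "\<dots> = ?e k"
    by (simp flip: single_add)
  finally show ?thesis .
qed

section \<open>Derivations into the coset module\<close>

lemma lattice_skew_mode: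
  "skew_mode (lattice_voa B L0 \<epsilon>) (lattice_module B L0 \<epsilon> \<gamma>) w n v =
     Sum_any (\<lambda>j. fock_scale ((-1) powi (n + int j + 1) / fact j)
       ((lattice_mode B \<epsilon> (lattice_conformal B) 0 ^^ j) (lattice_mode B \<epsilon> v (n + int j) w)))"
  by (simp add: skew_mode_def L_mod_def lattice_voa_def lattice_module_def)

lemma lattice_conformal_shift: "shift_op 0 (lattice_mode B \<epsilon> (lattice_conformal B) n)"
proof (rule lattice_mode_shift)
  fix b assume b: "b \<in> Poly_Mapping.keys (lattice_conformal B)"
  have "sector \<beta> (lattice_conformal B) = 0" if "\<beta> \<noteq> 0" for \<beta>
    using that by (simp add: lattice_conformal_def Let_def)
  then show "snd b = 0" using b by (metis sector_eq_0_iff imageI)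
qed

text \<open>Truncation of v_k w kills every term with j \<ge> N - n. Thus \<open>Sum_any\<close> in
  the skew mode is a genuine finite sum and not its default value.\<close>

lemma lattice_skew_mode_finite:
  "finite {j. fock_scale ((-1) powi (n + int j + 1) / fact j)
     ((lattice_mode B \<epsilon> (lattice_conformal B) 0 ^^ j) (lattice_mode B \<epsilon> v (n + int j) w)) \<noteq> 0}"
proof -
  obtain N where N: "\<And>k. k \<ge> N \<Longrightarrow> lattice_mode B \<epsilon> v k w = 0"
    using lattice_mode_truncation[of B \<epsilon> v w] unfolding eventually_at_top_linorder by blast
  have zero: "(lattice_mode B \<epsilon> (lattice_conformal B) 0 ^^ j) 0 = 0" for j
    by (rule shift_op_0[OF shift_op_funpow[OF lattice_conformal_shift]])
  have "lattice_mode B \<epsilon> v (n + int j) w = 0" if "j \<ge> nat (N - n)" for j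
    using that by (intro N) linarith
  then have "{j. fock_scale ((-1) powi (n + int j + 1) / fact j)
     ((lattice_mode B \<epsilon> (lattice_conformal B) 0 ^^ j) (lattice_mode B \<epsilon> v (n + int j) w)) \<noteq> 0}
     \<subseteq> {..<nat (N - n)}"
    by (force simp: zero not_le)
  then show ?thesis by (rule finite_subset) simp
qed

lemma lattice_skew_mode_linear:
  "fock_linear (skew_mode (lattice_voa B L0 \<epsilon>) (lattice_module B L0 \<epsilon> \<gamma>) w n)"
proof -
  have "fock_linear (\<lambda>v. fock_scale ((-1) powi (n + int j + 1) / fact j)
     ((lattice_mode B \<epsilon> (lattice_conformal B) 0 ^^ j) (lattice_mode B \<epsilon> v (n + int j) w)))" for j
    by (intro fock.linear_compose_scale_right fock_linear_compose[OF _ lattice_mode_linear]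
        shift_op_linear[OF shift_op_funpow[OF lattice_conformal_shift]])
  then have "fock_linear (\<lambda>v. Sum_any (\<lambda>j. fock_scale ((-1) powi (n + int j + 1) / fact j)
     ((lattice_mode B \<epsilon> (lattice_conformal B) 0 ^^ j) (lattice_mode B \<epsilon> v (n + int j) w))))"
    by (rule linear_combination_Sum_any) (rule lattice_skew_mode_finite)
  then show ?thesis
    by (simp flip: lattice_skew_mode[of B L0 \<epsilon> \<gamma>])
qed

text \<open>L(-1) preserves sectors and the modes of v shift them by \<alpha>. Here v is fixed and w
  varies: a component of w_n v then singles out one component of w.\<close>

lemma lattice_skew_mode_shift:
  assumes "\<And>b. b \<in> Poly_Mapping.keys v \<Longrightarrow> snd b = \<alpha>"
  shows "shift_op \<alpha> (\<lambda>w. skew_mode (lattice_voa B L0 \<epsilon>) (lattice_module B L0 \<epsilon> \<gamma>) w n v)"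
  unfolding lattice_skew_mode
  by (rule shift_op_Sum_any[OF shift_op_scaled lattice_skew_mode_finite],
      rule shift_op_compose_0[OF shift_op_funpow[OF lattice_conformal_shift]],
      rule lattice_mode_shift, rule assms)

lemma lattice_mode_generator:
  assumes "even_lattice B L0" "lattice_cocycle B L0 \<epsilon>" "v \<in> fock_space (dual_lattice B L0)"
  shows "lattice_mode B \<epsilon> (Poly_Mapping.single ({#(i, 0)#}, 0) 1) n v = heis B (axis i 1) n v"
proof -
  have "(SOME ws. mset ws = {#(i, 0::nat)#}) = [(i, 0)]"
    by (rule some_equality) auto
  then show ?thesis
    using word_mode_singleton[OF assms, of i n] by (simp only: lattice_mode_single fock.scale_one)
qed

lemma sector_heis_0: "sector \<delta> (heis B h 0 v) = fock_scale (B h \<delta>) (sector \<delta> v)"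
  by (rule fock_linear_eqI[OF fock_linear_compose[OF sector_linear shift_op_linear[OF heis_shift]]
        fock.linear_compose_scale_right[OF sector_linear]])
    (auto simp: heis_def)

lemma derivation_zero_mode:
  fixes B :: "complex^'n \<Rightarrow> complex^'n \<Rightarrow> complex"
  assumes lat: "even_lattice B L0" and coc: "lattice_cocycle B L0 \<epsilon>"
    and dual: "\<gamma> \<in> dual_lattice B L0" and gam: "\<gamma> \<notin> L0"
    and F: "is_derivation (lattice_voa B L0 \<epsilon>) (lattice_module B L0 \<epsilon> \<gamma>) F"
  shows "\<exists>w\<in>weight_space (lattice_module B L0 \<epsilon> \<gamma>) 1. \<forall>v\<in>fock_space L0.
    F v = skew_mode (lattice_voa B L0 \<epsilon>) (lattice_module B L0 \<epsilon> \<gamma>) w 0 v"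
proof -
  let ?skew = "skew_mode (lattice_voa B L0 \<epsilon>) (lattice_module B L0 \<epsilon> \<gamma>)"
  let ?coset = "(+) \<gamma> ` L0"
  let ?L_zero = "lattice_mode B \<epsilon> (lattice_conformal B) 1"
  define e :: "'n \<Rightarrow> 'n fock" where "e i = Poly_Mapping.single ({#(i, 0)#}, 0) 1" for i
  have F_space: "F u \<in> fock_space ?coset"
    and F_scale: "F (fock_scale c u) = fock_scale c (F u)"
    and F_L_zero: "F (?L_zero u) = ?L_zero (F u)"
    if "u \<in> fock_space L0" for u c
    using F that by (auto simp: is_derivation_def lattice_voa_def lattice_module_def L_alg_def)
  have F_add: "F (u + v) = F u + F v" if "u \<in> fock_space L0" "v \<in> fock_space L0" for u v
    using F that by (auto simp: is_derivation_def lattice_voa_def lattice_module_def)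
  have F_mode: "F (lattice_mode B \<epsilon> u n v) = lattice_mode B \<epsilon> u n (F v) + ?skew (F u) n v"
    if "u \<in> fock_space L0" "v \<in> fock_space L0" for u v n
    using F that unfolding is_derivation_def by (simp add: lattice_voa_def lattice_module_def)
  have e: "e i \<in> fock_space L0" for i
    using even_lattice_group(1)[OF lat] by (simp add: e_def fock_space_def)
  define a where "a i = F (e i)" for i
  have L_zero_a: "?L_zero (a i) = a i" for i
    using F_L_zero[OF e[of i]] conformal_weight_generator[OF lat coc, of i] by (simp add: a_def e_def)
  have sector_a: "sector \<beta> (a i) = 0" if "\<beta> \<notin> ?coset" for \<beta> i
    using F_space[OF e[of i]] that by (simp add: a_def fock_space_iff)
  have nonzero: "\<exists>i. B (axis i 1) \<beta> \<noteq> 0" if \<beta>: "\<beta> \<in> ?coset" for \<beta>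
  proof -
    obtain l where "l \<in> L0" "\<beta> = \<gamma> + l" using \<beta> by blast
    then have "\<beta> \<noteq> 0"
      using gam even_lattice_group(2)[OF lat even_lattice_group(1)[OF lat], of l]
      by (auto simp: add_eq_0_iff2)
    then show ?thesis using even_lattice_nondegenerate[OF lat] by blast
  qed
  \<comment> \<open>The index depends on \<beta> alone, so one w can serve all v. Outside the coset
    the values of \<open>idx\<close> and \<open>c\<close> do not matter, since every a_i has zero
    component there.\<close>
  define idx where "idx \<beta> = (SOME i. B (axis i 1) \<beta> \<noteq> 0)" for \<beta>
  define c where "c \<beta> = - 1 / B (axis (idx \<beta>) 1) \<beta>" for \<beta>
  \<comment> \<open>The finitely many sectors met by any a_i. They keep w a finite sum, and in all
    other sectors the formula for the component of w gives 0 as well.\<close>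
  define T where "T = (\<Union>i. snd ` Poly_Mapping.keys (a i))"
  define w where "w = (\<Sum>\<beta>\<in>T. fock_scale (c \<beta>) (sector \<beta> (a (idx \<beta>))))"
  have sector_w: "sector \<beta> w = fock_scale (c \<beta>) (sector \<beta> (a (idx \<beta>)))" for \<beta>
  proof -
    have "finite T" by (simp add: T_def)
    have "sector \<beta> w = (\<Sum>\<delta>\<in>T. if \<delta> = \<beta> then fock_scale (c \<beta>) (sector \<beta> (a (idx \<beta>))) else 0)"
      unfolding w_def by (auto simp: sector_sector intro!: sum.cong)
    moreover have "sector \<beta> (a (idx \<beta>)) = 0" if "\<beta> \<notin> T"
      using that by (auto simp: T_def sector_eq_0_iff)
    ultimately show ?thesis using \<open>finite T\<close> by auto
  qed
  \<comment> \<open>L(0) commutes with the projections, so each component of a weight one vector has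
    weight one.\<close>
  have "?L_zero w = w"
  proof (rule fock_eqI_sector)
    fix \<beta>
    have "sector \<beta> (?L_zero w) = ?L_zero (sector \<beta> w)"
      using shift_op_sector[OF lattice_conformal_shift, of \<beta>] by simp
    also have "\<dots> = fock_scale (c \<beta>) (sector (0 + \<beta>) (?L_zero (a (idx \<beta>))))"
      unfolding shift_op_sector[OF lattice_conformal_shift] sector_w
      by (rule shift_op_scale[OF lattice_conformal_shift])
    finally show "sector \<beta> (?L_zero w) = sector \<beta> w" by (simp add: L_zero_a sector_w)
  qed
  then have w: "w \<in> weight_space (lattice_module B L0 \<epsilon> \<gamma>) 1"
    by (simp add: weight_space_def lattice_module_def fock_space_iff sector_w sector_a)
  have basis: "F (Poly_Mapping.single b 1) = ?skew w 0 (Poly_Mapping.single b 1)" if b: "snd b \<in> L0" for b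
  proof (rule fock_eqI_sector)
    fix \<delta>
    let ?x = "Poly_Mapping.single b 1 :: 'n fock" and ?\<beta> = "\<delta> - snd b"
    have x: "?x \<in> fock_space L0" using b by (simp add: fock_space_def)
    then have x': "?x \<in> fock_space (dual_lattice B L0)"
      and Fx': "F ?x \<in> fock_space (dual_lattice B L0)"
      using even_lattice_group(3)[OF lat] coset_subset_dual_lattice[OF lat dual] F_space[OF x]
      by (auto simp: fock_space_def)
    have shift: "shift_op (snd b) (\<lambda>w. ?skew w 0 ?x)"
      by (rule lattice_skew_mode_shift) simp
    show "sector \<delta> (F ?x) = sector \<delta> (?skew w 0 ?x)"
    proof (cases "?\<beta> \<in> ?coset")
      case True
      define i where "i = idx ?\<beta>"
      have i: "B (axis i 1) ?\<beta> \<noteq> 0"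
        unfolding i_def idx_def using nonzero[OF True] by (rule someI_ex)
      have "heis B (axis i 1) 0 ?x = fock_scale (B (axis i 1) (snd b)) ?x"
        by (simp add: heis_def case_prod_unfold)
      then have "fock_scale (B (axis i 1) (snd b)) (F ?x) = heis B (axis i 1) 0 (F ?x) + ?skew (a i) 0 ?x"
        using F_mode[OF e x, of i 0] F_scale[OF x]
        by (simp add: e_def lattice_mode_generator[OF lat coc x'] lattice_mode_generator[OF lat coc Fx'] a_def
            del: fock_scale_single)
      \<comment> \<open>Projecting the derivation rule for e_i(0) to sector \<delta> turns e_i(0)
        into a scalar and leaves only the component of a_i at \<delta> - \<alpha>, where \<alpha> is
        the sector of the basis vector.\<close>
      then have "fock_scale (B (axis i 1) (snd b)) (sector \<delta> (F ?x)) =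
          fock_scale (B (axis i 1) \<delta>) (sector \<delta> (F ?x)) + ?skew (sector ?\<beta> (a i)) 0 ?x"
        using arg_cong[of _ _ "sector \<delta>"] shift_op_sector'[OF shift, of \<delta> "a i"]
        by (metis sector_heis_0 sector_simps(1,2))
      then have "?skew (sector ?\<beta> (a i)) 0 ?x =
          fock_scale (B (axis i 1) (snd b) - B (axis i 1) \<delta>) (sector \<delta> (F ?x))"
        by (simp add: fock.scale_left_diff_distrib)
      also have "B (axis i 1) (snd b) - B (axis i 1) \<delta> = - B (axis i 1) ?\<beta>"
        using even_lattice_expand(3)[OF lat, of "axis i 1" ?\<beta> "snd b"] by simp
      finally have "fock_scale (c ?\<beta>) (?skew (sector ?\<beta> (a i)) 0 ?x) = sector \<delta> (F ?x)"
        using i by (simp add: c_def i_def[symmetric])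
      then show ?thesis
        using shift_op_sector'[OF shift, of \<delta> w] shift_op_scale[OF shift, of "c ?\<beta>" "sector ?\<beta> (a i)"]
        by (simp add: sector_w i_def)
    next
      case False
      \<comment> \<open>As the sector of the basis vector lies in L0, membership in the coset is the
        same for \<delta> and for the difference; off the coset both sides are 0.\<close>
      then have "\<delta> \<notin> ?coset"
        using b even_lattice_group(2)[OF lat] by (force simp: image_iff algebra_simps)
      then have "sector \<delta> (F ?x) = 0"
        using F_space[OF x] by (simp add: fock_space_iff)
      moreover have "sector \<delta> (?skew w 0 ?x) = 0"
        using shift_op_sector'[OF shift, of \<delta> w] shift_op_0[OF shift] False
        by (simp add: sector_w sector_a)
      ultimately show ?thesis by simp
    qed
  qed
  have "F v = ?skew w 0 v" if v: "v \<in> fock_space L0" for v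
  proof -
    \<comment> \<open>F is additive and homogeneous only on V_L0, so the extension from basis
      vectors is an induction that also carries membership of the partial sums.\<close>
    let ?sum = "\<lambda>A. \<Sum>b\<in>A. fock_scale (Poly_Mapping.lookup v b) (Poly_Mapping.single b 1)"
    have "?sum A \<in> fock_space L0 \<and> F (?sum A) = ?skew w 0 (?sum A)"
      if "finite A" "A \<subseteq> Poly_Mapping.keys v" for A
      using that
    proof induction
      case empty
      have "(0 :: 'n fock) \<in> fock_space L0" by (simp add: fock_space_def)
      then have "F 0 = 0" using F_scale[of 0 0] by simp
      then show ?case by (simp add: fock.linear_0[OF lattice_skew_mode_linear] fock_space_def)
    next
      case (insert b A)
      have b: "snd b \<in> L0" using insert.prems v by (auto simp: fock_space_def)
      then have x: "Poly_Mapping.single b d \<in> fock_space L0" for d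
        by (simp add: fock_space_def)
      have IH: "?sum A \<in> fock_space L0" "F (?sum A) = ?skew w 0 (?sum A)"
        using insert by auto
      have "F (?sum (insert b A)) = F (fock_scale (Poly_Mapping.lookup v b) (Poly_Mapping.single b 1)) + F (?sum A)"
        using insert.hyps F_add[OF x IH(1)] by simp
      also have "\<dots> = ?skew w 0 (?sum (insert b A))"
        using insert.hyps by (simp only: F_scale[OF x] basis[OF b] IH(2) sum.insert not_False_eq_True
            fock.linear_add[OF lattice_skew_mode_linear] fock.linear_scale[OF lattice_skew_mode_linear])
      finally show ?case
        using insert.hyps IH(1) x by (auto simp: fock_space_iff)
    qed
    from this[OF finite_keys order.refl] show ?thesis
      unfolding fock_eq_sum_single[symmetric] by (rule conjunct2)
  qed
  then show ?thesis using w by blast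
qed

theorem theorem5p4:
  fixes B :: "complex^'n \<Rightarrow> complex^'n \<Rightarrow> complex"
    and L0 :: "(complex^'n) set"
    and \<epsilon> :: "complex^'n \<Rightarrow> complex^'n \<Rightarrow> complex"
    and \<gamma> :: "complex^'n"
  assumes "even_lattice B L0"
    and "lattice_cocycle B L0 \<epsilon>"
    and "\<gamma> \<in> dual_lattice B L0"
    and "\<gamma> \<notin> L0"
  shows "(\<forall>F. is_derivation (lattice_voa B L0 \<epsilon>) (lattice_module B L0 \<epsilon> \<gamma>) F \<longrightarrow>
              is_zero_mode_derivation (lattice_voa B L0 \<epsilon>) (lattice_module B L0 \<epsilon> \<gamma>) F) \<and>
         H1 (lattice_voa B L0 \<epsilon>) (lattice_module B L0 \<epsilon> \<gamma>) =
         Z1 (lattice_voa B L0 \<epsilon>) (lattice_module B L0 \<epsilon> \<gamma>)"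
proof -
  have "is_zero_mode_derivation (lattice_voa B L0 \<epsilon>) (lattice_module B L0 \<epsilon> \<gamma>) F"
    if "is_derivation (lattice_voa B L0 \<epsilon>) (lattice_module B L0 \<epsilon> \<gamma>) F" for F
    using derivation_zero_mode[OF assms that] that
    by (simp add: is_zero_mode_derivation_def lattice_voa_def)
  moreover have "is_derivation (lattice_voa B L0 \<epsilon>) (lattice_module B L0 \<epsilon> \<gamma>) F"
    if "is_zero_mode_derivation (lattice_voa B L0 \<epsilon>) (lattice_module B L0 \<epsilon> \<gamma>) F" for F
    using that by (simp add: is_zero_mode_derivation_def)
  ultimately show ?thesis
    unfolding H1_def Z1_def by blast
qed

end
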